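(* Let $Q=(B,D)$ be an invertible valued quiver of finite type, let $\mathbb{F}$ be a finite field and $q=|\mathbb{F}|$. Then for any indecomposable $V\in rep\,Q$, $$F_{X_V}\in 1+\sum_{\mathbf{e}\in\mathbb{Z}_{\ge0}^n\setminus\{0\}}q^{\frac12}\mathbb{Z}[q^{\frac12}]\,Z^{(\mathbf{e})}.$$
   Context: Notation: $\alpha_1,\dots,\alpha_n$ is the standard basis of $\mathbb{Z}^n$; $\mathbb{F}_k$ is the degree $k$ extension of $\mathbb{F}$ in a fixed algebraic closure. Valued quivers: an invertible valued quiver $Q=(B,D)$ is an invertible (over $\mathbb{Q}$) integer $n\times n$ matrix $B=(b_{ij})$ ($n$ even) together with $D=\mathrm{diag}(d_1,\dots,d_n)$, $d_i$ positive integers, such that $DB$ is skew-symmetric; it is regarded as the quiver with vertices $1,\dots,n$ with valuations $d_i$ and, whenever $b_{ij}>0$, $\gcd(|b_{ij}|,|b_{ji}|)$ arrows $i\to j$. $Q$ is of finite type if its Cartan counterpart $C=(c_{ij})$, $c_{ii}=2$, $c_{ij}=-|b_{ij}|$ for $i\neq j$, is a Cartan matrix of finite type. Quantum tori: $\Lambda_Q=(\lambda_{ij}):=-DB^{-1}$; $d$ is the least common multiple of the denominators of the $\lambda_{ij}$; $\mathcal{T}_{\Lambda_Q,q}=\mathbb{Z}[q^{\pm\frac1{2d}}]\langle X_1^{\pm1},\dots,X_n^{\pm1}\mid X_iX_j=q^{\lambda_{ij}}X_jX_i\rangle$ with skew field of fractions $\mathcal{F}_{\Lambda_Q,q}$,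 and $X^{(\mathbf{a})}:=q^{-\frac12\sum_{i<j}\lambda_{ij}a_ia_j}X_1^{a_1}\cdots X_n^{a_n}$. Likewise $\mathcal{T}_{DB,q}=\mathbb{Z}[q^{\pm\frac12}]\langle Z_1^{\pm1},\dots,Z_n^{\pm1}\mid Z_iZ_j=q^{d_ib_{ij}}Z_jZ_i\rangle$ with skew field of fractions $\mathcal{F}_{DB,q}$, and $Z^{(\mathbf{e})}:=q^{-\frac12\sum_{i<j}d_ib_{ij}e_ie_j}Z_1^{e_1}\cdots Z_n^{e_n}$. The assignment $Z_i\mapsto X^{(\mathbf{b}^i)}$, $\mathbf{b}^i$ the $i$-th column of $B$, defines an embedding of skew fields $j:\mathcal{F}_{DB,q}\to\mathcal{F}_{\Lambda_Q,q}$. Valued representations: an object $V$ of $rep\,Q$ assigns a finite-dimensional $\mathbb{F}_{d_i}$-vector space $V_i$ to each vertex $i$ and an $\mathbb{F}_{\gcd(d_i,d_j)}$-linear map $V_i\to V_j$ to each arrow $i\to j$; $[V]=\sum_i(\dim_{\mathbb{F}_{d_i}}V_i)\alpha_i$. The Euler form on $\mathbb{Z}^n$ is the bilinear form with $\langle\alpha_i,\alpha_i\rangle=d_i$ and $\langle\alpha_i,\alpha_j\rangle=-\max(0,d_ib_{ij})$ for $i\ne j$; ${}^*\mathbf{e}:=(\frac1{d_1}\langle\alpha_1,\mathbf{e}\rangle,\dots,\frac1{d_n}\langle\alpha_n,\mathbf{e}\rangle)$. $Gr_{\mathbf{e}}(V)$ is the finite set of subobjects $W\subset V$ with $[W]=\mathbf{e}$,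 and $$X_V=\sum_{\mathbf{e}}|\mathbb{F}|^{-\frac12\langle\mathbf{e},[V]-\mathbf{e}\rangle}|Gr_{\mathbf{e}}(V)|\,X^{(B\mathbf{e}-{}^*[V])}.$$ $F_{X_V}\in\mathcal{F}_{DB,q}$ denotes the $F$-factor of $X_V$ determined by $X_V=j(F_{X_V})X^{(-{}^*[V])}$. *)

theory Defs
  imports
    "HOL-Analysis.Analysis"
    "HOL-Algebra.Algebraic_Closure"
    "HOL-Library.Poly_Mapping"
begin

section \<open>Invertible valued quivers\<close>

text \<open>
  The vertices are the elements of a finite linearly ordered type \<open>'n\<close>; the order is the one used to
  write ordered monomials in the quantum tori. The diagonal matrix \<open>D\<close> is given by its entries
  \<open>d i\<close>, and \<open>B $ i $ j\<close> is \<open>b\<^sub>i\<^sub>j\<close>.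
\<close>

type_synonym 'n int_vec = "(int, 'n) vec"
type_synonym 'n int_mat = "((int, 'n) vec, 'n) vec"
type_synonym 'n rat_mat = "((rat, 'n) vec, 'n) vec"

definition rat_matrix :: "('n::finite) int_mat \<Rightarrow> 'n rat_mat" where
  "rat_matrix B = (\<chi> i j. of_int (B $ i $ j))"

definition diag_matrix :: "('n::finite \<Rightarrow> nat) \<Rightarrow> 'n rat_mat" where
  "diag_matrix d = (\<chi> i j. if i = j then of_nat (d i) else 0)"

definition invertible_valued_quiver :: "('n::finite) int_mat \<Rightarrow> ('n \<Rightarrow> nat) \<Rightarrow> bool" where
  "invertible_valued_quiver B d \<longleftrightarrow>
     even CARD('n) \<and>
     (\<forall>i. 0 < d i) \<and>
     invertible (rat_matrix B) \<and>
     transpose (diag_matrix d ** rat_matrix B) = - (diag_matrix d ** rat_matrix B)"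

definition cartan_counterpart :: "('n::finite) int_mat \<Rightarrow> 'n int_mat" where
  "cartan_counterpart B = (\<chi> i j. if i = j then 2 else - \<bar>B $ i $ j\<bar>)"

text \<open>
  A Cartan matrix of finite type is a symmetrizable generalized Cartan matrix whose symmetrization is
  positive definite.
\<close>

definition cartan_matrix_of_finite_type :: "('n::finite) int_mat \<Rightarrow> bool" where
  "cartan_matrix_of_finite_type C \<longleftrightarrow>
     (\<forall>i. C $ i $ i = 2) \<and>
     (\<forall>i j. i \<noteq> j \<longrightarrow> C $ i $ j \<le> 0) \<and>
     (\<forall>i j. C $ i $ j = 0 \<longleftrightarrow> C $ j $ i = 0) \<and>
     (\<exists>s::'n \<Rightarrow> real. (\<forall>i. 0 < s i) \<and>
        (\<forall>i j. s i * of_int (C $ i $ j) = s j * of_int (C $ j $ i)) \<and>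
        (\<forall>x::real^'n. x \<noteq> 0 \<longrightarrow>
           0 < (\<Sum>i\<in>UNIV. \<Sum>j\<in>UNIV. s i * of_int (C $ i $ j) * x $ i * x $ j)))"

definition of_finite_type :: "('n::finite) int_mat \<Rightarrow> bool" where
  "of_finite_type B \<longleftrightarrow> cartan_matrix_of_finite_type (cartan_counterpart B)"

definition euler_form :: "('n::finite) int_mat \<Rightarrow> ('n \<Rightarrow> nat) \<Rightarrow> 'n int_vec \<Rightarrow> 'n int_vec \<Rightarrow> int" where
  "euler_form B d e f =
     (\<Sum>i\<in>UNIV. \<Sum>j\<in>UNIV.
        e $ i * f $ j * (if i = j then int (d i) else - max 0 (int (d i) * B $ i $ j)))"

text \<open>The division is exact, since \<open>d\<^sub>i\<close> divides \<open>\<langle>\<alpha>\<^sub>i, e\<rangle>\<close>.\<close>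

definition left_star :: "('n::finite) int_mat \<Rightarrow> ('n \<Rightarrow> nat) \<Rightarrow> 'n int_vec \<Rightarrow> 'n int_vec" where
  "left_star B d e = (\<chi> i. euler_form B d (axis i 1) e div int (d i))"


section \<open>Quantum tori\<close>

text \<open>The subring \<open>\<int>[S]\<close> of the reals generated by \<open>S\<close>.\<close>

inductive_set int_adjoin :: "real set \<Rightarrow> real set" for S :: "real set" where
  of_int: "of_int k \<in> int_adjoin S"
| gen: "x \<in> S \<Longrightarrow> x \<in> int_adjoin S"
| add: "x \<in> int_adjoin S \<Longrightarrow> y \<in> int_adjoin S \<Longrightarrow> x + y \<in> int_adjoin S"
| mult: "x \<in> int_adjoin S \<Longrightarrow> y \<in> int_adjoin S \<Longrightarrow> x * y \<in> int_adjoin S"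

text \<open>
  The algebra over \<open>R\<close> generated by \<open>X\<^sub>1\<^sup>\<plusminus>\<^sup>1, \<dots>, X\<^sub>n\<^sup>\<plusminus>\<^sup>1\<close> subject to
  \<open>X\<^sub>i X\<^sub>j = q\<^bsup>M\<^sub>i\<^sub>j\<^esup> X\<^sub>j X\<^sub>i\<close> (\<open>M\<close> skew-symmetric) is free over \<open>R\<close> on the ordered monomials
  \<open>X\<^sup>a = X\<^sub>1\<^bsup>a\<^sub>1\<^esup> \<cdots> X\<^sub>n\<^bsup>a\<^sub>n\<^esup>\<close>, represented here by \<open>single a 1\<close>. Reordering the product of two ordered
  monomials moves \<open>X\<^sub>j\<^bsup>b\<^sub>j\<^esup>\<close> to the left of \<open>X\<^sub>i\<^bsup>a\<^sub>i\<^esup>\<close> for all \<open>j < i\<close>, which gives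
  \<open>X\<^sup>a X\<^sup>b = q\<^bsup>reorder_exp M a b\<^esup> X\<^bsup>a + b\<^esup>\<close>. The deformation parameter \<open>q\<close> is a number, and its
  fractional powers are the positive real ones.
\<close>

type_synonym 'n torus = "'n int_vec \<Rightarrow>\<^sub>0 real"

definition reorder_exp :: "('n::{finite,linorder}) rat_mat \<Rightarrow> 'n int_vec \<Rightarrow> 'n int_vec \<Rightarrow> rat" where
  "reorder_exp M a b = (\<Sum>(i, j)\<in>{(i, j). j < i}. M $ i $ j * of_int (a $ i * b $ j))"

definition quantum_torus ::
  "real set \<Rightarrow> real \<Rightarrow> ('n::{finite,linorder}) rat_mat \<Rightarrow> 'n torus ring" where
  "quantum_torus R q M =
     \<lparr>carrier = {f. \<forall>a. Poly_Mapping.lookup f a \<in> R},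
      mult = (\<lambda>f g. \<Sum>a\<in>Poly_Mapping.keys f. \<Sum>b\<in>Poly_Mapping.keys g.
                Poly_Mapping.single (a + b)
                  (q powr of_rat (reorder_exp M a b) * Poly_Mapping.lookup f a * Poly_Mapping.lookup g b)),
      one = Poly_Mapping.single 0 1,
      zero = 0,
      add = (+)\<rparr>"

definition torus_scalar :: "real \<Rightarrow> ('n::finite) torus" where
  "torus_scalar c = Poly_Mapping.single 0 c"

definition torus_scale :: "real \<Rightarrow> ('n::finite) torus \<Rightarrow> 'n torus" where
  "torus_scale c f = Poly_Mapping.map ((*) c) f"

definition torus_monom :: "('n::finite) int_vec \<Rightarrow> 'n torus" where
  "torus_monom a = Poly_Mapping.single a 1"

lemma quantum_torus_mult_single:
  "Poly_Mapping.single a x \<otimes>\<^bsub>quantum_torus R q M\<^esub> Poly_Mapping.single b y =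
   Poly_Mapping.single (a + b) (q powr of_rat (reorder_exp M a b) * x * y)"
  by (cases "x = 0"; cases "y = 0") (simp_all add: quantum_torus_def)

text \<open>The defining relations of the quantum torus.\<close>

lemma quantum_torus_relation:
  fixes M :: "('n::{finite,linorder}) rat_mat"
  assumes "transpose M = - M" and "q > 0"
  shows "torus_monom (axis i 1) \<otimes>\<^bsub>quantum_torus R q M\<^esub> torus_monom (axis j 1) =
    torus_scale (q powr of_rat (M $ i $ j))
      (torus_monom (axis j 1) \<otimes>\<^bsub>quantum_torus R q M\<^esub> torus_monom (axis i 1))"
proof -
  have skew: "M $ a $ b = - M $ b $ a" for a b
    using assms(1) by (metis (no_types, lifting) transpose_def vec_lambda_beta vector_uminus_component)
  have exp: "reorder_exp M (axis a 1) (axis b 1) = (if b < a then M $ a $ b else 0)" for a b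
  proof -
    have "reorder_exp M (axis a 1) (axis b 1) =
        (\<Sum>p\<in>{(i, j). j < i}. if p = (a, b) then M $ a $ b else 0)"
      unfolding reorder_exp_def by (rule sum.cong) (auto simp: axis_def split: if_splits)
    then show ?thesis by (simp add: sum.delta)
  qed
  have scale: "torus_scale c (Poly_Mapping.single a x) = Poly_Mapping.single a (c * x)"
    for c x and a :: "'n int_vec"
    by (rule poly_mapping_eqI)
      (simp add: torus_scale_def Poly_Mapping.map.rep_eq lookup_single when_def)
  have "M $ i $ i = 0" using skew[of i i] by simp
  moreover have "of_rat (M $ i $ j) = - (of_rat (M $ j $ i) :: real)"
    using skew[of i j] by (simp add: of_rat_minus)
  ultimately show ?thesis
    unfolding torus_monom_def quantum_torus_mult_single scale exp using assms(2)
    by (cases i j rule: linorder_cases) (auto simp: add.commute powr_minus)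
qed

lemma reorder_exp_add_left: "reorder_exp M (a + b) c = reorder_exp M a c + reorder_exp M b c"
  by (simp add: reorder_exp_def case_prod_unfold algebra_simps sum.distrib)

lemma reorder_exp_add_right: "reorder_exp M a (b + c) = reorder_exp M a b + reorder_exp M a c"
  by (simp add: reorder_exp_def case_prod_unfold algebra_simps sum.distrib)

text \<open>Associativity on monomials.\<close>

lemma quantum_torus_single_assoc:
  fixes a b c :: "('n::{finite,linorder}) int_vec"
  shows "(Poly_Mapping.single a x \<otimes>\<^bsub>quantum_torus R q M\<^esub> Poly_Mapping.single b y)
      \<otimes>\<^bsub>quantum_torus R q M\<^esub> Poly_Mapping.single c z =
    Poly_Mapping.single a x \<otimes>\<^bsub>quantum_torus R q M\<^esub>
      (Poly_Mapping.single b y \<otimes>\<^bsub>quantum_torus R q M\<^esub> Poly_Mapping.single c z)"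
  by (simp add: quantum_torus_mult_single reorder_exp_add_left reorder_exp_add_right
      of_rat_add powr_add ac_simps)

text \<open>The normalized monomials \<open>X\<^bsup>(a)\<^esup>\<close> and \<open>Z\<^bsup>(e)\<^esup>\<close>.\<close>

definition normalized_monom ::
  "real \<Rightarrow> ('n::{finite,linorder}) rat_mat \<Rightarrow> 'n int_vec \<Rightarrow> 'n torus" where
  "normalized_monom q M a =
     torus_scale
       (q powr of_rat (- (1/2) * (\<Sum>(i, j)\<in>{(i, j). i < j}. M $ i $ j * of_int (a $ i * a $ j))))
       (torus_monom a)"

definition Lambda_matrix :: "('n::finite) int_mat \<Rightarrow> ('n \<Rightarrow> nat) \<Rightarrow> 'n rat_mat" where
  "Lambda_matrix B d = - (diag_matrix d ** matrix_inv (rat_matrix B))"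

definition DB_matrix :: "('n::finite) int_mat \<Rightarrow> ('n \<Rightarrow> nat) \<Rightarrow> 'n rat_mat" where
  "DB_matrix B d = diag_matrix d ** rat_matrix B"

definition denominator_lcm :: "('n::finite) rat_mat \<Rightarrow> int" where
  "denominator_lcm M = Lcm {snd (quotient_of (M $ i $ j)) | i j. True}"

definition torus_Lambda ::
  "real \<Rightarrow> ('n::{finite,linorder}) int_mat \<Rightarrow> ('n \<Rightarrow> nat) \<Rightarrow> 'n torus ring" where
  "torus_Lambda q B d =
     (let r = 1 / (2 * of_int (denominator_lcm (Lambda_matrix B d)))
      in quantum_torus (int_adjoin {q powr r, q powr - r}) q (Lambda_matrix B d))"

definition torus_DB ::
  "real \<Rightarrow> ('n::{finite,linorder}) int_mat \<Rightarrow> ('n \<Rightarrow> nat) \<Rightarrow> 'n torus ring" where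
  "torus_DB q B d =
     quantum_torus (int_adjoin {q powr (1/2), q powr - (1/2)}) q (DB_matrix B d)"

definition skew_field :: "('a, 'm) ring_scheme \<Rightarrow> bool" where
  "skew_field K \<longleftrightarrow> ring K \<and> \<one>\<^bsub>K\<^esub> \<noteq> \<zero>\<^bsub>K\<^esub> \<and> carrier K - {\<zero>\<^bsub>K\<^esub>} \<subseteq> Units K"

text \<open>
  \<open>K\<close>, with the embedding \<open>\<iota>\<close>, is a skew field of fractions of \<open>R\<close>. For an Ore domain, such as a
  quantum torus, it exists and is unique up to a unique isomorphism over \<open>R\<close>.
\<close>

definition skew_field_of_fractions ::
  "('a, 'm) ring_scheme \<Rightarrow> ('b, 'l) ring_scheme \<Rightarrow> ('a \<Rightarrow> 'b) \<Rightarrow> bool" where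
  "skew_field_of_fractions R K \<iota> \<longleftrightarrow>
     skew_field K \<and> \<iota> \<in> ring_hom R K \<and> inj_on \<iota> (carrier R) \<and>
     (\<forall>x\<in>carrier K. \<exists>a\<in>carrier R. \<exists>b\<in>carrier R - {\<zero>\<^bsub>R\<^esub>}.
        x = \<iota> a \<otimes>\<^bsub>K\<^esub> inv\<^bsub>K\<^esub> (\<iota> b))"

text \<open>
  The homomorphism of \<open>\<int>[q\<^bsup>\<plusminus>1/2\<^esup>]\<close>-algebras \<open>\<F>\<^bsub>DB,q\<^esub> \<rightarrow> \<F>\<^bsub>\<Lambda>,q\<^esub>\<close> (injective, as the
  source is a skew field) with \<open>Z\<^sub>i \<mapsto> X\<^bsup>(b\<^sup>i)\<^esup>\<close>. The \<open>Z\<^sub>i\<close> and the scalars generate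
  \<open>\<F>\<^bsub>DB,q\<^esub>\<close> as a skew field, so it is determined by these values.
\<close>

definition column_embedding ::
  "real \<Rightarrow> ('n::{finite,linorder}) int_mat \<Rightarrow> ('n \<Rightarrow> nat) \<Rightarrow>
   ('z, 'm) ring_scheme \<Rightarrow> ('n torus \<Rightarrow> 'z) \<Rightarrow>
   ('x, 'l) ring_scheme \<Rightarrow> ('n torus \<Rightarrow> 'x) \<Rightarrow> ('z \<Rightarrow> 'x) \<Rightarrow> bool" where
  "column_embedding q B d K\<^sub>Z \<iota>\<^sub>Z K\<^sub>X \<iota>\<^sub>X j \<longleftrightarrow>
     j \<in> ring_hom K\<^sub>Z K\<^sub>X \<and>
     (\<forall>c\<in>int_adjoin {q powr (1/2), q powr - (1/2)}.
        j (\<iota>\<^sub>Z (torus_scalar c)) = \<iota>\<^sub>X (torus_scalar c)) \<and>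
     (\<forall>i. j (\<iota>\<^sub>Z (torus_monom (axis i 1))) =
          \<iota>\<^sub>X (normalized_monom q (Lambda_matrix B d) (column i B)))"


section \<open>Valued representations\<close>

text \<open>
  \<open>L\<close> is an algebraic closure of the finite field \<open>F \<subseteq> L\<close>; it contains exactly one extension of \<open>F\<close>
  of each degree \<open>k \<ge> 1\<close>.
\<close>

definition degree_extension :: "('k, 'm) ring_scheme \<Rightarrow> 'k set \<Rightarrow> nat \<Rightarrow> 'k set" where
  "degree_extension L F k = (THE E. subfield E L \<and> F \<subseteq> E \<and> ring.dimension L k F E)"

abbreviation degree_field :: "('k, 'm) ring_scheme \<Rightarrow> 'k set \<Rightarrow> nat \<Rightarrow> ('k, 'm) ring_scheme" where
  "degree_field L F k \<equiv> L\<lparr>carrier := degree_extension L F k\<rparr>"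

definition has_vs_dim :: "('k, 'm) ring_scheme \<Rightarrow> ('k, 'v, 'l) module_scheme \<Rightarrow> nat \<Rightarrow> bool" where
  "has_vs_dim K M n \<longleftrightarrow>
     (\<exists>b. (\<forall>k<n. b k \<in> carrier M) \<and>
        bij_betw (\<lambda>c. \<Oplus>\<^bsub>M\<^esub>k\<in>{..<n}. c k \<odot>\<^bsub>M\<^esub> b k)
          ({..<n} \<rightarrow>\<^sub>E carrier K) (carrier M))"

definition vs_dim :: "('k, 'm) ring_scheme \<Rightarrow> ('k, 'v, 'l) module_scheme \<Rightarrow> nat" where
  "vs_dim K M = (THE n. has_vs_dim K M n)"

text \<open>
  \<open>rep_map V i j a\<close> is the map attached to the \<open>a\<close>-th arrow \<open>i \<rightarrow> j\<close>; it is irrelevant unless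
  \<open>b\<^sub>i\<^sub>j > 0\<close> and \<open>a < gcd(|b\<^sub>i\<^sub>j|, |b\<^sub>j\<^sub>i|)\<close>.
\<close>

record ('n, 'k, 'v) valued_rep =
  rep_space :: "'n \<Rightarrow> ('k, 'v) module"
  rep_map :: "'n \<Rightarrow> 'n \<Rightarrow> nat \<Rightarrow> 'v \<Rightarrow> 'v"

definition arrows :: "('n::finite) int_mat \<Rightarrow> ('n \<times> 'n \<times> nat) set" where
  "arrows B = {(i, j, a). B $ i $ j > 0 \<and> int a < gcd \<bar>B $ i $ j\<bar> \<bar>B $ j $ i\<bar>}"

definition linear_over ::
  "'k set \<Rightarrow> ('k, 'v, 'l) module_scheme \<Rightarrow> ('k, 'w, 'o) module_scheme \<Rightarrow> ('v \<Rightarrow> 'w) \<Rightarrow> bool" where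
  "linear_over E M N f \<longleftrightarrow>
     f \<in> carrier M \<rightarrow> carrier N \<and>
     (\<forall>x\<in>carrier M. \<forall>y\<in>carrier M. f (x \<oplus>\<^bsub>M\<^esub> y) = f x \<oplus>\<^bsub>N\<^esub> f y) \<and>
     (\<forall>c\<in>E. \<forall>x\<in>carrier M. f (c \<odot>\<^bsub>M\<^esub> x) = c \<odot>\<^bsub>N\<^esub> f x)"

definition valued_representation ::
  "('k, 'm) ring_scheme \<Rightarrow> 'k set \<Rightarrow> ('n::finite) int_mat \<Rightarrow> ('n \<Rightarrow> nat) \<Rightarrow> ('n, 'k, 'v) valued_rep \<Rightarrow> bool" where
  "valued_representation L F B d V \<longleftrightarrow>
     (\<forall>i. Module.module (degree_field L F (d i)) (rep_space V i) \<and>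
          (\<exists>n. has_vs_dim (degree_field L F (d i)) (rep_space V i) n)) \<and>
     (\<forall>(i, j, a)\<in>arrows B.
        linear_over (degree_extension L F (gcd (d i) (d j)))
          (rep_space V i) (rep_space V j) (rep_map V i j a))"

definition subobject ::
  "('k, 'm) ring_scheme \<Rightarrow> 'k set \<Rightarrow> ('n::finite) int_mat \<Rightarrow> ('n \<Rightarrow> nat) \<Rightarrow> ('n, 'k, 'v) valued_rep \<Rightarrow>
   ('n \<Rightarrow> 'v set) \<Rightarrow> bool" where
  "subobject L F B d V W \<longleftrightarrow>
     (\<forall>i. submodule (W i) (degree_field L F (d i)) (rep_space V i)) \<and>
     (\<forall>(i, j, a)\<in>arrows B. rep_map V i j a ` W i \<subseteq> W j)"

definition dim_vector ::
  "('k, 'm) ring_scheme \<Rightarrow> 'k set \<Rightarrow> ('n::finite \<Rightarrow> nat) \<Rightarrow> ('n, 'k, 'v) valued_rep \<Rightarrow>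
   ('n \<Rightarrow> 'v set) \<Rightarrow> 'n int_vec" where
  "dim_vector L F d V W =
     (\<chi> i. int (vs_dim (degree_field L F (d i)) ((rep_space V i)\<lparr>carrier := W i\<rparr>)))"

definition total_dim_vector ::
  "('k, 'm) ring_scheme \<Rightarrow> 'k set \<Rightarrow> ('n::finite \<Rightarrow> nat) \<Rightarrow> ('n, 'k, 'v) valued_rep \<Rightarrow> 'n int_vec" where
  "total_dim_vector L F d V = dim_vector L F d V (\<lambda>i. carrier (rep_space V i))"

definition quiver_Gr ::
  "('k, 'm) ring_scheme \<Rightarrow> 'k set \<Rightarrow> ('n::finite) int_mat \<Rightarrow> ('n \<Rightarrow> nat) \<Rightarrow> ('n, 'k, 'v) valued_rep \<Rightarrow>
   'n int_vec \<Rightarrow> ('n \<Rightarrow> 'v set) set" where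
  "quiver_Gr L F B d V e = {W. subobject L F B d V W \<and> dim_vector L F d V W = e}"

definition indecomposable_rep ::
  "('k, 'm) ring_scheme \<Rightarrow> 'k set \<Rightarrow> ('n::finite) int_mat \<Rightarrow> ('n \<Rightarrow> nat) \<Rightarrow> ('n, 'k, 'v) valued_rep \<Rightarrow> bool" where
  "indecomposable_rep L F B d V \<longleftrightarrow>
     (\<exists>i. carrier (rep_space V i) \<noteq> {\<zero>\<^bsub>rep_space V i\<^esub>}) \<and>
     (\<forall>U W. subobject L F B d V U \<and> subobject L F B d V W \<and>
        (\<forall>i. \<forall>x\<in>carrier (rep_space V i).
           \<exists>!(u, w). u \<in> U i \<and> w \<in> W i \<and> x = u \<oplus>\<^bsub>rep_space V i\<^esub> w) \<longrightarrow>
        (\<forall>i. U i = {\<zero>\<^bsub>rep_space V i\<^esub>}) \<or> (\<forall>i. W i = {\<zero>\<^bsub>rep_space V i\<^esub>}))"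


section \<open>Quantum cluster characters and their F-factors\<close>

text \<open>The terms with \<open>Gr\<^sub>e(V)\<close> empty are zero; leaving them out makes the sum finite.\<close>

definition cluster_character ::
  "('k, 'm) ring_scheme \<Rightarrow> 'k set \<Rightarrow> ('n::{finite,linorder}) int_mat \<Rightarrow> ('n \<Rightarrow> nat) \<Rightarrow>
   ('n, 'k, 'v) valued_rep \<Rightarrow> 'n torus" where
  "cluster_character L F B d V =
     (let q = real (card F); v = total_dim_vector L F d V in
      \<Sum>e | quiver_Gr L F B d V e \<noteq> {}.
        torus_scale
          (q powr (- (1/2) * of_int (euler_form B d e (v - e))) *
           real (card (quiver_Gr L F B d V e)))
          (normalized_monom q (Lambda_matrix B d) (B *v e - left_star B d v)))"

definition F_factor ::
  "('k, 'm) ring_scheme \<Rightarrow> 'k set \<Rightarrow> ('n::{finite,linorder}) int_mat \<Rightarrow> ('n \<Rightarrow> nat) \<Rightarrow>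
   ('z, 'o) ring_scheme \<Rightarrow> ('x, 'l) ring_scheme \<Rightarrow> ('n torus \<Rightarrow> 'x) \<Rightarrow> ('z \<Rightarrow> 'x) \<Rightarrow>
   ('n, 'k, 'v) valued_rep \<Rightarrow> 'z" where
  "F_factor L F B d K\<^sub>Z K\<^sub>X \<iota>\<^sub>X j V =
     (THE f. f \<in> carrier K\<^sub>Z \<and>
        \<iota>\<^sub>X (cluster_character L F B d V) =
        j f \<otimes>\<^bsub>K\<^sub>X\<^esub>
          \<iota>\<^sub>X (normalized_monom (real (card F)) (Lambda_matrix B d)
                (- left_star B d (total_dim_vector L F d V))))"

text \<open>The set \<open>1 + \<Sum>\<^sub>e q\<^bsup>1/2\<^esup> \<int>[q\<^bsup>1/2\<^esup>] Z\<^bsup>(e)\<^esup>\<close>, \<open>e\<close> running over the nonzero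
  vectors with nonnegative entries.\<close>

definition one_plus_positive ::
  "real \<Rightarrow> ('n::{finite,linorder}) int_mat \<Rightarrow> ('n \<Rightarrow> nat) \<Rightarrow> 'n torus set" where
  "one_plus_positive q B d =
     {\<one>\<^bsub>torus_DB q B d\<^esub> + (\<Sum>e\<in>S. torus_scale (c e) (normalized_monom q (DB_matrix B d) e)) | S c.
        finite S \<and> S \<subseteq> {e. (\<forall>i. 0 \<le> e $ i) \<and> e \<noteq> 0} \<and>
        (\<forall>e\<in>S. \<exists>x\<in>int_adjoin {q powr (1/2)}. c e = q powr (1/2) * x)}"

end

theory Submission
  imports Defs
begin

text \<open>
  Here \<open>q\<close> is a number, so the F-factor can be computed in closed form: it is
  \<open>\<Sum>\<^sub>e q\<^bsup>\<langle>e, e\<rangle>/2\<^esup> |Gr\<^sub>e(V)| Z\<^bsup>(e)\<^esup>\<close>. Indeed \<open>B\<^sup>T \<Lambda> = D\<close> gives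
  \<open>X\<^bsup>(Be - *v)\<^esup> = q\<^bsup>\<langle>e, v\<rangle>/2\<^esup> X\<^bsup>(Be)\<^esup> X\<^bsup>(-*v)\<^esup>\<close> for \<open>v = [V]\<close>, which changes the exponent
  \<open>-\<langle>e, v - e\<rangle>/2\<close> of the character into \<open>\<langle>e, e\<rangle>/2\<close> (lemma \<open>character_term\<close>), and \<open>j\<close> maps \<open>Z\<^bsup>(e)\<^esup>\<close> to
  \<open>X\<^bsup>(Be)\<^esup>\<close> (\<open>j_monom\<close>). The factor is unique because \<open>X\<^bsup>(-*v)\<^esup>\<close> is invertible and \<open>j\<close> is
  injective (\<open>right_cancel_X\<close>).

  Two facts then finish the proof. In finite type the quadratic form \<open>\<langle>e, e\<rangle>\<close> is positive definite and
  integral, so \<open>\<langle>e, e\<rangle> \<ge> 1\<close> for \<open>e \<noteq> 0\<close> and the coefficient lies in \<open>q\<^bsup>1/2\<^esup> \<int>[q\<^bsup>1/2\<^esup>]\<close>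
  (\<open>euler_form_pos\<close>). And the zero subobject is the only one of dimension vector \<open>0\<close>, so the constant term
  is \<open>1\<close> (\<open>Gr_zero\<close>).

  The last fact, and the finiteness of the sum over \<open>e\<close> (\<open>finite_nonempty_Gr\<close>), rest on the field of scalars at
  each vertex being a finite field, over which every submodule of a finite module has a dimension. That
  in turn needs the existence and uniqueness of the extension of degree \<open>k\<close> of a finite field \<open>F\<close> inside an algebraic
  closure, which is the set of fixed points of \<open>x \<mapsto> x\<^sup>Q\<close> for \<open>Q = |F|\<^sup>k\<close>
  (\<open>degree_extension_eq_frobenius_fixed\<close>).
\<close>

section \<open>Finite fields inside an algebraic closure\<close>

text \<open>
  Polynomial functions of degree less than \<open>n\<close>. The coefficient list may have leading zeros, so that
  the bound on its length is stable under sums.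
\<close>

definition (in ring) poly_fun :: "nat \<Rightarrow> ('a \<Rightarrow> 'a) \<Rightarrow> bool" where
  "poly_fun n f \<longleftrightarrow>
     (\<exists>p. set p \<subseteq> carrier R \<and> length p \<le> n \<and> (\<forall>x\<in>carrier R. f x = eval p x))"

lemma (in ring) poly_fun_const: "c \<in> carrier R \<Longrightarrow> 0 < n \<Longrightarrow> poly_fun n (\<lambda>_. c)"
  unfolding poly_fun_def by (rule exI[of _ "[c]"]) auto

lemma (in ring) poly_fun_add:
  assumes "poly_fun n f" and "poly_fun n g"
  shows "poly_fun n (\<lambda>x. f x \<oplus> g x)"
proof -
  obtain p r where p: "set p \<subseteq> carrier R" "length p \<le> n" "\<forall>x\<in>carrier R. f x = eval p x"
    and r: "set r \<subseteq> carrier R" "length r \<le> n" "\<forall>x\<in>carrier R. g x = eval r x"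
    using assms unfolding poly_fun_def by blast
  show ?thesis
    unfolding poly_fun_def
  proof (intro exI[of _ "poly_add p r"] conjI ballI)
    show "set (poly_add p r) \<subseteq> carrier R"
      using poly_add_in_carrier p r by blast
    show "length (poly_add p r) \<le> n"
      using poly_add_length_le[of p r] p(2) r(2) by linarith
    show "f x \<oplus> g x = eval (poly_add p r) x" if "x \<in> carrier R" for x
      using eval_poly_add[OF p(1) r(1) that] p(3) r(3) that by simp
  qed
qed

lemma (in ring) poly_fun_times_var:
  assumes "poly_fun n f" shows "poly_fun (Suc n) (\<lambda>x. f x \<otimes> x)"
proof -
  obtain p where p: "set p \<subseteq> carrier R" "length p \<le> n" "\<forall>x\<in>carrier R. f x = eval p x"
    using assms unfolding poly_fun_def by blast
  have "f x \<otimes> x = eval (p @ [\<zero>]) x" if "x \<in> carrier R" for x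
    using eval_append_aux[OF p(1) zero_closed that] p(3) that eval_in_carrier[OF p(1) that]
    by simp
  then show ?thesis
    unfolding poly_fun_def using p by (intro exI[of _ "p @ [\<zero>]"]) auto
qed

lemma (in ring) poly_fun_mono: "poly_fun n f \<Longrightarrow> n \<le> m \<Longrightarrow> poly_fun m f"
  unfolding poly_fun_def by (meson order_trans)

lemma (in ring) poly_fun_closed: "poly_fun n f \<Longrightarrow> x \<in> carrier R \<Longrightarrow> f x \<in> carrier R"
  unfolding poly_fun_def using eval_in_carrier by metis

lemma (in ring) poly_fun_power: "poly_fun (Suc m) (\<lambda>x. x [^] m)"
proof (induction m)
  case 0
  show ?case using poly_fun_const[of \<one> "Suc 0"] by simp
next
  case (Suc m)
  show ?case using poly_fun_times_var[OF Suc] by simp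
qed

text \<open>
  Only the degree of \<open>(X + 1)\<^sup>m - X\<^sup>m\<close> matters below, so a recursion for the difference replaces the
  binomial theorem.
\<close>

lemma (in cring) power_plus_one:
  "\<exists>g. poly_fun m g \<and> (\<forall>x\<in>carrier R. (x \<oplus> \<one>) [^] m = x [^] m \<oplus> g x)"
proof (induction m)
  case 0
  show ?case unfolding poly_fun_def
    by (intro exI[of _ "\<lambda>_. \<zero>"] conjI exI[of _ "[]"]) auto
next
  case (Suc m)
  then obtain g where g: "poly_fun m g" "\<And>x. x \<in> carrier R \<Longrightarrow> (x \<oplus> \<one>) [^] m = x [^] m \<oplus> g x"
    by blast
  have "poly_fun (Suc m) (\<lambda>x. x [^] m \<oplus> (g x \<otimes> x \<oplus> g x))"
    by (intro poly_fun_add poly_fun_power poly_fun_times_var g(1) poly_fun_mono[OF g(1)]) simp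
  moreover have "(x \<oplus> \<one>) [^] Suc m = x [^] Suc m \<oplus> (x [^] m \<oplus> (g x \<otimes> x \<oplus> g x))"
    if x: "x \<in> carrier R" for x
  proof -
    have [simp]: "g x \<in> carrier R" using poly_fun_closed[OF g(1) x] .
    have "(x \<oplus> \<one>) [^] Suc m = (x [^] m \<oplus> g x) \<otimes> (x \<oplus> \<one>)"
      using g(2)[OF x] by simp
    also have "\<dots> = x [^] m \<otimes> x \<oplus> (x [^] m \<oplus> (g x \<otimes> x \<oplus> g x))"
      using x by (simp add: l_distr r_distr a_ac)
    finally show ?thesis by simp
  qed
  ultimately show ?case by blast
qed

lemma (in field) poly_fun_zero:
  assumes f: "poly_fun n f" and A: "A \<subseteq> carrier R" "finite A" "n \<le> card A"
    and zero: "\<And>x. x \<in> A \<Longrightarrow> f x = \<zero>" and x: "x \<in> carrier R"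
  shows "f x = \<zero>"
proof -
  obtain p where p: "set p \<subseteq> carrier R" "length p \<le> n" "\<forall>x\<in>carrier R. f x = eval p x"
    using f unfolding poly_fun_def by blast
  define r where "r = normalize p"
  have r: "r \<in> carrier (poly_ring R)"
    unfolding r_def using normalize_gives_polynomial[OF p(1)] univ_poly_carrier by blast
  have ev: "f y = eval r y" if "y \<in> carrier R" for y
    unfolding r_def using eval_normalize[OF p(1) that] p(3) that by simp
  have "r = []"
  proof (rule ccontr)
    assume "r \<noteq> []"
    then have "A \<subseteq> set_mset (roots r)"
      using zero ev A(1) by (auto simp: roots_mem_iff_is_root[OF r] is_root_def subset_iff)
    then have "card A \<le> card (set_mset (roots r))" by (simp add: card_mono)
    also have "\<dots> \<le> size (roots r)"
      unfolding size_multiset_overloaded_eq card_eq_sum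
      by (intro sum_mono) (simp add: Suc_leI)
    also have "\<dots> \<le> degree r" using size_roots_le_degree[OF r] .
    also have "\<dots> < length r" using \<open>r \<noteq> []\<close> by (simp add: length_greater_0_conv)
    also have "\<dots> \<le> n" unfolding r_def using normalize_length_le[of p] p(2) by linarith
    finally show False using A(3) by simp
  qed
  then show ?thesis using ev[OF x] by simp
qed

lemma (in field) finite_subfield_power_card:
  assumes E: "subfield E R" "finite E" and x: "x \<in> E"
  shows "x [^] card E = x"
proof (cases "x = \<zero>")
  case True
  have "card E \<noteq> 0" using E(2) x by auto
  then show ?thesis using True by (simp add: nat_pow_zero)
next
  case False
  interpret E: field "R\<lparr>carrier := E\<rparr>" using subfield_iff(2)[OF E(1)] .
  have EX: "E \<subseteq> carrier R" using subfieldE(3)[OF E(1)] .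
  have "x [^]\<^bsub>Multiplicative_Group.mult_of (R\<lparr>carrier := E\<rparr>)\<^esub>
      order (Multiplicative_Group.mult_of (R\<lparr>carrier := E\<rparr>)) = \<one>"
    using group.pow_order_eq_1[OF E.field_mult_group, of x] False x by simp
  moreover have "order (Multiplicative_Group.mult_of (R\<lparr>carrier := E\<rparr>)) = card E - 1"
    using E(2) subringE(2)[OF subfieldE(1)[OF E(1)]] by (simp add: order_def)
  ultimately have one: "x [^] (card E - 1) = \<one>"
    by (simp add: Multiplicative_Group.nat_pow_mult_of nat_pow_consistent[symmetric])
  have "card E > 0" using E(2) x card_gt_0_iff by blast
  then have "x [^] card E = x [^] (card E - 1) \<otimes> x"
    by (metis Suc_pred' nat_pow_Suc)
  then show ?thesis using one x EX by auto
qed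

lemma (in field) finite_subfield_card:
  assumes "subfield E R" "finite E"
  shows "2 \<le> card E"
proof -
  have "{\<zero>, \<one>} \<subseteq> E" using subringE(2,3)[OF subfieldE(1)[OF assms(1)]] by simp
  from card_mono[OF assms(2) this] show ?thesis by simp
qed

text \<open>
  A proof that does not pass through the characteristic. Let \<open>q = |F|\<close>. The polynomial
  \<open>(X + 1)\<^sup>q - X\<^sup>q - 1\<close> has degree less than \<open>q\<close> and, since \<open>a\<^sup>q = a\<close> on \<open>F\<close>, it vanishes at the \<open>q\<close>
  elements of \<open>F\<close>; hence it vanishes on the whole field. Homogenizing \<open>(t + 1)\<^sup>q = t\<^sup>q + 1\<close> with
  \<open>t = x / y\<close> gives additivity.
\<close>

lemma (in field) frobenius_add:
  assumes F: "subfield F R" "finite F" and x: "x \<in> carrier R" and y: "y \<in> carrier R"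
  shows "(x \<oplus> y) [^] card F = x [^] card F \<oplus> y [^] card F"
proof -
  let ?q = "card F"
  have FX: "F \<subseteq> carrier R" using subfieldE(3)[OF F(1)] .
  have q: "?q > 0" using finite_subfield_card[OF F] by linarith
  obtain g where g: "poly_fun ?q g" "\<And>x. x \<in> carrier R \<Longrightarrow> (x \<oplus> \<one>) [^] ?q = x [^] ?q \<oplus> g x"
    using power_plus_one by blast
  have h: "poly_fun ?q (\<lambda>x. g x \<oplus> \<ominus> \<one>)"
    by (intro poly_fun_add g(1) poly_fun_const) (use q in auto)
  have gF: "g a \<oplus> \<ominus> \<one> = \<zero>" if a: "a \<in> F" for a
  proof -
    have aX: "a \<in> carrier R" and [simp]: "g a \<in> carrier R" using a FX poly_fun_closed[OF g(1)] by auto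
    have "a \<oplus> \<one> \<in> F"
      using subringE(3,7)[OF subfieldE(1)[OF F(1)]] a by blast
    then have "a \<oplus> \<one> = a \<oplus> g a"
      using g(2)[OF aX] finite_subfield_power_card[OF F] a by metis
    then have "g a = \<one>" using aX by simp
    then show ?thesis by (simp add: r_neg)
  qed
  have g1: "g t = \<one>" if t: "t \<in> carrier R" for t
    using poly_fun_zero[OF h FX F(2) order.refl gF t] poly_fun_closed[OF g(1) t]
      r_right_minus_eq[of "g t" \<one>] by (simp add: a_minus_def)
  show ?thesis
  proof (cases "y = \<zero>")
    case True
    then show ?thesis using x q by (simp add: nat_pow_zero)
  next
    case False
    then have yU: "y \<in> Units R" using y field_Units by blast
    define t where "t = x \<otimes> inv y"
    have t: "t \<in> carrier R" unfolding t_def using x yU by simp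
    have xt: "x = t \<otimes> y" unfolding t_def using x y yU by (simp add: m_assoc)
    have "x \<oplus> y = (t \<oplus> \<one>) \<otimes> y" using t y by (simp add: xt l_distr)
    then have "(x \<oplus> y) [^] ?q = (t [^] ?q \<oplus> \<one>) \<otimes> y [^] ?q"
      using g(2)[OF t] g1[OF t] t y by (simp add: nat_pow_distrib)
    also have "\<dots> = x [^] ?q \<oplus> y [^] ?q"
      using t y by (simp add: xt l_distr nat_pow_distrib)
    finally show ?thesis .
  qed
qed

lemma (in field) frobenius_power_add:
  assumes F: "subfield F R" "finite F" and x: "x \<in> carrier R" and y: "y \<in> carrier R"
  shows "(x \<oplus> y) [^] (card F ^ k) = x [^] (card F ^ k) \<oplus> y [^] (card F ^ k)"
proof (induction k)
  case 0
  show ?case using x y by simp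
next
  case (Suc k)
  have eq: "z [^] (card F ^ Suc k) = (z [^] (card F ^ k)) [^] card F" if "z \<in> carrier R" for z
    using that by (simp add: nat_pow_pow mult.commute)
  show ?case
    using Suc frobenius_add[OF F, of "x [^] (card F ^ k)" "y [^] (card F ^ k)"] x y
    by (simp only: eq a_closed nat_pow_closed)
qed

text \<open>
  For \<open>N = |F|\<^sup>k\<close> this is the extension of \<open>F\<close> of degree \<open>k\<close>.
\<close>

definition (in ring) frobenius_fixed :: "nat \<Rightarrow> 'a set" where
  "frobenius_fixed N = {x \<in> carrier R. x [^] N = x}"

lemma (in field) subfield_frobenius_fixed:
  assumes F: "subfield F R" "finite F"
  shows "subfield (frobenius_fixed (card F ^ k)) R"
proof (rule subfieldI')
  let ?Q = "card F ^ k"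
  have Q: "?Q > 0" using finite_subfield_card[OF F] by simp
  show "subring (frobenius_fixed ?Q) R"
  proof (rule subringI)
    show "\<ominus> h \<in> frobenius_fixed ?Q" if "h \<in> frobenius_fixed ?Q" for h
    proof -
      have h: "h \<in> carrier R" "h [^] ?Q = h" using that by (auto simp: frobenius_fixed_def)
      have "(\<ominus> h \<oplus> h) [^] ?Q = (\<ominus> h) [^] ?Q \<oplus> h [^] ?Q"
        using frobenius_power_add[OF F, of "\<ominus> h" h] h(1) by simp
      then have "(\<ominus> h) [^] ?Q \<oplus> h = \<zero>"
        using h Q by (simp add: l_neg nat_pow_zero)
      then have "(\<ominus> h) [^] ?Q = \<ominus> h" using minus_equality[of "(\<ominus> h) [^] ?Q" h] h(1) by simp
      then show ?thesis using h by (simp add: frobenius_fixed_def)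
    qed
  qed (auto simp: frobenius_fixed_def nat_pow_distrib frobenius_power_add[OF F])
  show "inv x \<in> frobenius_fixed ?Q" if "x \<in> frobenius_fixed ?Q - {\<zero>}" for x
  proof -
    have x: "x \<in> Units R" "x [^] ?Q = x" using that field_Units by (auto simp: frobenius_fixed_def)
    have "x [^] ?Q \<otimes> inv x [^] ?Q = (x \<otimes> inv x) [^] ?Q"
      using x(1) by (intro nat_pow_distrib[symmetric]) auto
    then have "x \<otimes> inv x [^] ?Q = \<one>" using x by simp
    then have "inv x = inv x [^] ?Q" using x(1) by (intro comm_inv_char) auto
    then show ?thesis using x(1) by (simp add: frobenius_fixed_def)
  qed
qed

lemma (in field) subfield_subset_frobenius_fixed:
  assumes F: "subfield F R" "finite F"
  shows "F \<subseteq> frobenius_fixed (card F ^ k)"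
proof
  fix x assume x: "x \<in> F"
  then have xX: "x \<in> carrier R" using subfieldE(3)[OF F(1)] by auto
  have "x [^] (card F ^ k) = x"
  proof (induction k)
    case (Suc k)
    then show ?case
      using finite_subfield_power_card[OF F x] nat_pow_pow[OF xX, of "card F ^ k" "card F"]
      by (simp add: mult.commute)
  qed (use xX in simp)
  then show "x \<in> frobenius_fixed (card F ^ k)" using xX by (simp add: frobenius_fixed_def)
qed

text \<open>
  The polynomial \<open>X\<^sup>N - X + c\<close>. With \<open>c = 1\<close> and \<open>N = |L|\<close> it would have no root in a finite field
  \<open>L\<close>; with \<open>c = 0\<close> and \<open>N = |F|\<^sup>k\<close> its roots form the extension of degree \<open>k\<close>.
\<close>

lemma (in field) trinomial_poly:
  assumes "2 \<le> N" and c: "c \<in> carrier R"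
  obtains p where "p \<in> carrier (poly_ring R)" and "degree p = N"
    and "\<And>x. x \<in> carrier R \<Longrightarrow> eval p x = x [^] N \<oplus> (\<ominus> x \<oplus> c)"
proof
  let ?p = "poly_add (Polynomials.ring.monom R \<one> N) [\<ominus> \<one>, c]"
  have m: "polynomial (carrier R) (Polynomials.ring.monom R \<one> N)"
    by (intro monom_is_polynomial[OF carrier_is_subring]) auto
  have l: "polynomial (carrier R) [\<ominus> \<one>, c]"
    using c one_not_zero by (auto simp: polynomial_def)
  show "?p \<in> carrier (poly_ring R)"
    using poly_add_closed[OF carrier_is_subring m l] univ_poly_carrier by blast
  have "degree (Polynomials.ring.monom R \<one> N) = N"
    by (simp add: ring.monom_def[OF ring_axioms])
  then show "degree ?p = N"
    using poly_add_degree_eq[OF carrier_is_subring m l] assms(1) by simp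
  show "eval ?p x = x [^] N \<oplus> (\<ominus> x \<oplus> c)" if x: "x \<in> carrier R" for x
    using eval_poly_add[OF polynomial_incl[OF m] polynomial_incl[OF l] x] eval_monom[OF one_closed x]
      x c by (simp add: l_minus)
qed

lemma (in algebraically_closed) infinite_carrier: "infinite (carrier L)"
proof
  assume fin: "finite (carrier L)"
  have sf: "subfield (carrier L) L" using carrier_is_subfield .
  obtain p where p: "p \<in> carrier (poly_ring L)" "degree p = card (carrier L)"
    "\<And>x. x \<in> carrier L \<Longrightarrow> eval p x = x [^] card (carrier L) \<oplus> (\<ominus> x \<oplus> \<one>)"
    using trinomial_poly[OF finite_subfield_card[OF sf fin] one_closed] by blast
  have "size (roots p) > 0"
    using roots_over_carrier[OF p(1)] p(2) finite_subfield_card[OF sf fin]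
    by (simp add: splitted_def)
  then obtain x where "x \<in># roots p"
    by (metis multiset_nonemptyE size_empty less_irrefl)
  then have x: "x \<in> carrier L" "eval p x = \<zero>"
    using roots_mem_iff_is_root[OF p(1)] by (auto simp: is_root_def)
  have "x \<oplus> (\<ominus> x \<oplus> \<one>) = \<zero>"
    using p(3)[OF x(1)] x finite_subfield_power_card[OF sf fin x(1)] by simp
  then show False using x(1) by (simp add: r_neg2)
qed

text \<open>
  The polynomial \<open>X\<^sup>Q - X\<close> splits, so it is enough that each root \<open>a\<close> is simple. As \<open>a\<^sup>Q = a\<close> and the
  \<open>Q\<close>-th power is additive, \<open>X\<^sup>Q - X = (X - a)\<^sup>Q - (X - a)\<close>. If this were \<open>(X - a)\<^sup>2 s\<close>, then
  \<open>(X - a)\<^bsup>Q-1\<^esup> - 1 = (X - a) s\<close> would hold away from \<open>a\<close>, hence everywhere because the field is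
  infinite; at \<open>a\<close> it reads \<open>-1 = 0\<close>.
\<close>

lemma (in algebraically_closed) card_frobenius_fixed:
  assumes F: "subfield F L" "finite F" and k: "0 < k"
  shows "finite (frobenius_fixed (card F ^ k))" and "card (frobenius_fixed (card F ^ k)) = card F ^ k"
proof -
  let ?Q = "card F ^ k"
  have "card F ^ 1 \<le> card F ^ k"
    using finite_subfield_card[OF F] k by (intro power_increasing) auto
  then have Q: "2 \<le> ?Q" using finite_subfield_card[OF F] by simp
  then obtain M where M: "?Q = Suc M" "0 < M" by (cases ?Q) auto
  obtain p where p: "p \<in> carrier (poly_ring L)" "degree p = ?Q"
    "\<And>x. x \<in> carrier L \<Longrightarrow> eval p x = x [^] ?Q \<oplus> (\<ominus> x \<oplus> \<zero>)"
    using trinomial_poly[OF Q zero_closed] by blast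
  have ev: "eval p x = x [^] ?Q \<ominus> x" if "x \<in> carrier L" for x
    using p(3)[OF that] that by (simp add: a_minus_def)
  have pn: "p \<noteq> []"
  proof
    assume "p = []"
    then have "?Q = 0" using p(2) by simp
    then show False using Q by linarith
  qed
  have set: "set_mset (roots p) = frobenius_fixed ?Q"
    using ev pn
    by (auto simp: roots_mem_iff_is_root[OF p(1)] is_root_def frobenius_fixed_def r_right_minus_eq)
  interpret UP: domain "poly_ring L" using univ_poly_is_domain[OF carrier_is_subring] .
  have simple: "count (roots p) a = 1" if a: "a \<in> frobenius_fixed ?Q" for a
  proof -
    have aX: "a \<in> carrier L" and aQ: "a [^] ?Q = a" using a by (auto simp: frobenius_fixed_def)
    define l where "l = [\<one>, \<ominus> a]"
    have l: "l \<in> carrier (poly_ring L)"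
      unfolding l_def univ_poly_carrier[symmetric] polynomial_def using aX by auto
    have el: "eval l t = t \<ominus> a" if "t \<in> carrier L" for t
      unfolding l_def using that aX by (simp add: a_minus_def)
    have "\<not> 2 \<le> alg_mult p a"
    proof
      assume "2 \<le> alg_mult p a"
      then have "(l [^]\<^bsub>poly_ring L\<^esub> (2::nat)) pdivides p"
        unfolding l_def using le_alg_mult_imp_pdivides[OF aX p(1)] by blast
      then obtain s where s: "s \<in> carrier (poly_ring L)"
        "p = l [^]\<^bsub>poly_ring L\<^esub> (2::nat) \<otimes>\<^bsub>poly_ring L\<^esub> s"
        unfolding pdivides_def factor_def by blast
      \<comment> \<open>The difference of the two sides after one factor \<open>X - a\<close> is cancelled; it has infinitely
        many roots, but \<open>r(a) = -1\<close>.\<close>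
      define r where "r = l [^]\<^bsub>poly_ring L\<^esub> M \<ominus>\<^bsub>poly_ring L\<^esub> (\<one>\<^bsub>poly_ring L\<^esub> \<oplus>\<^bsub>poly_ring L\<^esub> l \<otimes>\<^bsub>poly_ring L\<^esub> s)"
      have r: "r \<in> carrier (poly_ring L)" unfolding r_def using l s(1) by simp
      have er: "eval r t = (t \<ominus> a) [^] M \<ominus> (\<one> \<oplus> (t \<ominus> a) \<otimes> eval s t)"
        if t: "t \<in> carrier L" for t
      proof -
        interpret ev: ring_hom_cring "poly_ring L" L "\<lambda>p. eval p t"
          using eval_cring_hom[OF carrier_is_subring t] .
        show ?thesis unfolding r_def using l s(1) el[OF t] by (simp add: a_minus_def)
      qed
      have root: "eval r t = \<zero>" if t: "t \<in> carrier L" "t \<noteq> a" for t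
      proof -
        interpret ev: ring_hom_cring "poly_ring L" L "\<lambda>p. eval p t"
          using eval_cring_hom[OF carrier_is_subring t(1)] .
        define u where "u = t \<ominus> a"
        have u: "u \<in> carrier L" "u \<noteq> \<zero>" unfolding u_def using t aX by auto
        have tu: "t = u \<oplus> a" unfolding u_def using t aX by (simp add: a_minus_def a_assoc l_neg)
        have st: "eval s t \<in> carrier L" using s(1) by simp
        have cancel: "v \<ominus> u = (v \<oplus> a) \<ominus> (u \<oplus> a)" if "v \<in> carrier L" for v
          using that u(1) aX by algebra
        have "u [^] ?Q \<ominus> u = t [^] ?Q \<ominus> t"
          using frobenius_power_add[OF F u(1) aX] aQ u(1) cancel[of "u [^] ?Q"]
          by (simp add: tu)
        also have "\<dots> = u [^] (2::nat) \<otimes> eval s t"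
          using ev[OF t(1)] s l el[OF t(1)] by (simp add: u_def)
        finally have "u \<otimes> (u [^] M \<ominus> \<one>) = u \<otimes> (u \<otimes> eval s t)"
          using u st by (simp add: M(1) numeral_2_eq_2 a_minus_def r_distr r_minus m_ac)
        then have "u [^] M \<ominus> \<one> = u \<otimes> eval s t"
          using u st m_lcancel[of u "u [^] M \<ominus> \<one>" "u \<otimes> eval s t"] by simp
        moreover have "v \<ominus> (\<one> \<oplus> w) = (v \<ominus> \<one>) \<ominus> w"
          if "v \<in> carrier L" "w \<in> carrier L" for v w
          using that by algebra
        ultimately have "u [^] M \<ominus> (\<one> \<oplus> u \<otimes> eval s t) = \<zero>"
          using u st by (simp add: r_right_minus_eq)
        then show ?thesis using er[OF t(1)] by (simp add: u_def)
      qed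
      have "eval r a = \<ominus> \<one>"
        using er[OF aX] M(2) aX eval_poly_in_carrier[OF carrier_is_subring, of s a] s(1)
        by (simp add: a_minus_def r_neg nat_pow_zero univ_poly_carrier)
      moreover have "\<ominus> \<one> \<noteq> \<zero>"
        using minus_minus[OF one_closed] one_not_zero by (metis minus_zero)
      ultimately have "r \<noteq> []" by (metis eval.simps(1))
      then have "carrier L - {a} \<subseteq> {x. is_root r x}" using root by (auto simp: is_root_def)
      then have "finite (carrier L - {a})"
        using finite_number_of_roots[OF r] finite_subset by blast
      then show False using infinite_carrier by simp
    qed
    moreover have "alg_mult p a = count (roots p) a" using alg_mult_eq_count_roots[OF p(1)] by simp
    moreover have "count (roots p) a > 0" using a set by simp
    ultimately show ?thesis by linarith
  qed
  have "size (roots p) = card (frobenius_fixed ?Q)"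
    unfolding size_multiset_overloaded_eq set using simple by simp
  moreover have "size (roots p) = ?Q"
    using roots_over_carrier[OF p(1)] p(2) by (simp add: splitted_def)
  ultimately show "card (frobenius_fixed ?Q) = ?Q" by simp
  show "finite (frobenius_fixed ?Q)" using set[symmetric] by simp
qed

lemma (in ring) card_of_dimension:
  assumes "dimension n F E" and "subfield F R" and "finite F"
  shows "finite E \<and> card E = card F ^ n"
  using assms
proof (induction rule: dimension.induct)
  case (zero_dim K)
  show ?case by simp
next
  case (Suc_dim v E n K)
  have K: "K \<subseteq> carrier R" using subfieldE(3)[OF Suc_dim.prems(1)] .
  have fin: "finite E" "card E = card K ^ n" using Suc_dim by auto
  obtain Us where Us: "set Us \<subseteq> carrier R" "Span K Us = E"
    using exists_base[OF Suc_dim.prems(1) Suc_dim.hyps(3)] by blast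
  note sp = Span_subgroup_props[OF Suc_dim.prems(1) Us(1), unfolded Us(2)]
  note inv = Span_m_inv_simprule[OF Suc_dim.prems(1) Us(1), unfolded Us(2)]
  have sub: "a \<oplus> \<ominus> b \<in> K" if "a \<in> K" "b \<in> K" for a b
    using that subringE(5,7)[OF subfieldE(1)[OF Suc_dim.prems(1)]] by blast
  have "inj_on (\<lambda>(k, w). k \<otimes> v \<oplus> w) (K \<times> E)"
  proof (rule inj_onI, clarify)
    fix k w k' w'
    assume kw: "k \<in> K" "w \<in> E" "k' \<in> K" "w' \<in> E" and eq: "k \<otimes> v \<oplus> w = k' \<otimes> v \<oplus> w'"
    have X: "k \<in> carrier R" "k' \<in> carrier R" "w \<in> carrier R" "w' \<in> carrier R"
      using kw K sp(1) by auto
    have "(k \<oplus> \<ominus> k') \<otimes> v = ((k \<otimes> v \<oplus> w) \<oplus> \<ominus> (k' \<otimes> v \<oplus> w')) \<oplus> (w' \<oplus> \<ominus> w)"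
      using X Suc_dim.hyps(1) by algebra
    also have "\<dots> = w' \<oplus> \<ominus> w"
      using X Suc_dim.hyps(1) by (simp add: eq r_neg)
    also have "\<dots> \<in> E" using sp(3,4) kw by blast
    finally have mem: "(k \<oplus> \<ominus> k') \<otimes> v \<in> E" .
    have "k \<oplus> \<ominus> k' = \<zero>"
      using inv[of "k \<oplus> \<ominus> k'" v] mem sub[OF kw(1,3)] Suc_dim.hyps(1,2) by blast
    then have "k = k'" using X by (simp add: a_minus_def[symmetric] r_right_minus_eq)
    then show "k = k' \<and> w = w'" using eq X Suc_dim.hyps(1) by simp
  qed
  moreover have "line_extension K v E = (\<lambda>(k, w). k \<otimes> v \<oplus> w) ` (K \<times> E)"
    by (auto simp: line_extension_mem_iff) blast
  ultimately show ?case
    using fin Suc_dim.prems(2) by (simp add: card_image card_cartesian_product)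
qed

lemma (in ring) finite_dimension_of_finite_subfield:
  assumes F: "subfield F R" and E: "subfield E R" "finite E" "F \<subseteq> E"
  shows "finite_dimension F E"
proof -
  obtain Us where Us: "set Us = E" using finite_list[OF E(2)] by blast
  have EX: "E \<subseteq> carrier R" using subfieldE(3)[OF E(1)] .
  have "subalgebra F E R"
    using subringE(6)[OF subfieldE(1)[OF E(1)]] E(3)
      subring.axioms(1)[OF subfieldE(1)[OF E(1)]]
    by (auto simp: subalgebra_def subalgebra_axioms_def)
  then have "Span F Us = E"
    using subalgebra_Span_incl[OF F _ , of E Us] Span_base_incl[OF F, of Us] Us EX by auto
  then show ?thesis using Span_finite_dimension[OF F, of Us] Us EX by simp
qed

text \<open>
  A subfield of dimension \<open>k\<close> over \<open>F\<close> has \<open>|F|\<^sup>k\<close> elements, all of which are fixed by the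
  \<open>|F|\<^sup>k\<close>-th power; as there are only that many fixed elements, it consists of all of them.
\<close>

lemma (in algebraically_closed) degree_extension_eq_frobenius_fixed:
  assumes F: "subfield F L" "finite F" and k: "0 < k"
  shows "degree_extension L F k = frobenius_fixed (card F ^ k)"
  unfolding degree_extension_def
proof (rule the_equality)
  let ?E = "frobenius_fixed (card F ^ k)"
  have E: "subfield ?E L" using subfield_frobenius_fixed[OF F] .
  have FE: "F \<subseteq> ?E" using subfield_subset_frobenius_fixed[OF F] .
  note card = card_frobenius_fixed[OF F k]
  obtain n where n: "dimension n F ?E"
    using finite_dimension_of_finite_subfield[OF F(1) E card(1) FE]
    by (auto simp: finite_dimension_def)
  have "card F ^ n = card F ^ k"
    using card_of_dimension[OF n F] card(2) by simp
  then have "n = k" using finite_subfield_card[OF F] by (simp add: power_inject_exp)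
  then show "subfield ?E L \<and> F \<subseteq> ?E \<and> dimension k F ?E" using E FE n by simp
  fix E'
  assume E': "subfield E' L \<and> F \<subseteq> E' \<and> dimension k F E'"
  then have fin: "finite E'" "card E' = card F ^ k" using card_of_dimension F by blast+
  have X: "x \<in> carrier L" if "x \<in> E'" for x using E' subfieldE(3) that by blast
  have "E' \<subseteq> ?E"
    using finite_subfield_power_card[of E'] E' fin X by (auto simp: frobenius_fixed_def)
  then show "E' = ?E"
    using card_subset_eq[OF card(1)] card(2) fin(2) by simp
qed

text \<open>
  This gives content to the definite description behind \<open>degree_extension\<close>: without existence and
  uniqueness the scalars of a valued representation would be an unspecified set.
\<close>

lemma finite_degree_extension:
  assumes "algebraic_closure L F" and "finite F" and "0 < k"
  shows "subfield (degree_extension L F k) L" and "finite (degree_extension L F k)"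
proof -
  interpret algebraic_closure L F by fact
  have F: "subfield F L" using subfield_axioms .
  show "subfield (degree_extension L F k) L" "finite (degree_extension L F k)"
    using degree_extension_eq_frobenius_fixed[OF F assms(2,3)]
      subfield_frobenius_fixed[OF F assms(2)] card_frobenius_fixed[OF F assms(2,3)] by simp_all
qed

section \<open>Dimension over a finite field\<close>

context module
begin

lemma lincomb_closed:
  assumes "c \<in> {..<n::nat} \<rightarrow> carrier R" and "\<And>k. k < n \<Longrightarrow> b k \<in> carrier M"
  shows "(\<Oplus>\<^bsub>M\<^esub>k\<in>{..<n}. c k \<odot>\<^bsub>M\<^esub> b k) \<in> carrier M"
  using assms by (intro M.finsum_closed) (auto simp: Pi_iff)

lemma lincomb_Suc:
  assumes "c \<in> {..<Suc n} \<rightarrow> carrier R" and "\<And>k. k < Suc n \<Longrightarrow> b k \<in> carrier M"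
  shows "(\<Oplus>\<^bsub>M\<^esub>k\<in>{..<Suc n}. c k \<odot>\<^bsub>M\<^esub> b k) =
    c n \<odot>\<^bsub>M\<^esub> b n \<oplus>\<^bsub>M\<^esub> (\<Oplus>\<^bsub>M\<^esub>k\<in>{..<n}. c k \<odot>\<^bsub>M\<^esub> b k)"
  unfolding lessThan_Suc using assms by (subst M.finsum_insert) (auto simp: Pi_iff)

lemma lincomb_cong:
  assumes "c \<in> {..<n::nat} \<rightarrow> carrier R" and "\<And>k. k < n \<Longrightarrow> b k \<in> carrier M"
    and "\<And>k. k < n \<Longrightarrow> c' k = c k" and "\<And>k. k < n \<Longrightarrow> b' k = b k"
  shows "(\<Oplus>\<^bsub>M\<^esub>k\<in>{..<n}. c' k \<odot>\<^bsub>M\<^esub> b' k) = (\<Oplus>\<^bsub>M\<^esub>k\<in>{..<n}. c k \<odot>\<^bsub>M\<^esub> b k)"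
  using assms by (intro M.finsum_cong') (auto simp: Pi_iff)

lemma lincomb_linear:
  assumes "u \<in> carrier R" "v \<in> carrier R"
    and "c \<in> {..<n::nat} \<rightarrow> carrier R" and "c' \<in> {..<n} \<rightarrow> carrier R"
    and "\<And>k. k < n \<Longrightarrow> b k \<in> carrier M"
  shows "u \<odot>\<^bsub>M\<^esub> (\<Oplus>\<^bsub>M\<^esub>k\<in>{..<n}. c k \<odot>\<^bsub>M\<^esub> b k) \<oplus>\<^bsub>M\<^esub> v \<odot>\<^bsub>M\<^esub> (\<Oplus>\<^bsub>M\<^esub>k\<in>{..<n}. c' k \<odot>\<^bsub>M\<^esub> b k) =
    (\<Oplus>\<^bsub>M\<^esub>k\<in>{..<n}. (u \<otimes> c k \<oplus> v \<otimes> c' k) \<odot>\<^bsub>M\<^esub> b k)"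
  using assms(3-5)
proof (induction n)
  case 0
  then show ?case using assms(1,2) by simp
next
  case (Suc n)
  have b: "b k \<in> carrier M" if "k \<le> n" for k using Suc.prems(3)[of k] that by simp
  have c: "c k \<in> carrier R" "c' k \<in> carrier R" if "k \<le> n" for k
    using Suc.prems(1,2) that by (auto simp: Pi_iff)
  let ?x = "\<Oplus>\<^bsub>M\<^esub>k\<in>{..<n}. c k \<odot>\<^bsub>M\<^esub> b k" and ?x' = "\<Oplus>\<^bsub>M\<^esub>k\<in>{..<n}. c' k \<odot>\<^bsub>M\<^esub> b k"
  have x: "?x \<in> carrier M" "?x' \<in> carrier M"
    using lincomb_closed[of c n b] lincomb_closed[of c' n b] b c by (auto simp: Pi_iff)
  have IH: "u \<odot>\<^bsub>M\<^esub> ?x \<oplus>\<^bsub>M\<^esub> v \<odot>\<^bsub>M\<^esub> ?x' = (\<Oplus>\<^bsub>M\<^esub>k\<in>{..<n}. (u \<otimes> c k \<oplus> v \<otimes> c' k) \<odot>\<^bsub>M\<^esub> b k)"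
    using Suc.IH b c by (auto simp: Pi_iff)
  have "(\<Oplus>\<^bsub>M\<^esub>k\<in>{..<Suc n}. (u \<otimes> c k \<oplus> v \<otimes> c' k) \<odot>\<^bsub>M\<^esub> b k) =
      (u \<otimes> c n \<oplus> v \<otimes> c' n) \<odot>\<^bsub>M\<^esub> b n \<oplus>\<^bsub>M\<^esub> (u \<odot>\<^bsub>M\<^esub> ?x \<oplus>\<^bsub>M\<^esub> v \<odot>\<^bsub>M\<^esub> ?x')"
    unfolding IH using b c assms(1,2) by (intro lincomb_Suc) (auto simp: Pi_iff)
  also have "\<dots> = u \<odot>\<^bsub>M\<^esub> (c n \<odot>\<^bsub>M\<^esub> b n \<oplus>\<^bsub>M\<^esub> ?x) \<oplus>\<^bsub>M\<^esub> v \<odot>\<^bsub>M\<^esub> (c' n \<odot>\<^bsub>M\<^esub> b n \<oplus>\<^bsub>M\<^esub> ?x')"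
    using x b[of n] c[of n] assms(1,2)
    by (simp add: smult_l_distr smult_r_distr smult_assoc1 M.a_ac)
  finally show ?case
    using lincomb_Suc[of c n b] lincomb_Suc[of c' n b] Suc.prems by simp
qed

end

text \<open>
  Linear independence of \<open>b 0, \<dots>, b (n - 1)\<close>, in the form in which \<open>has_vs_dim\<close> uses it.
\<close>

definition independent_family :: "('k, 'm) ring_scheme \<Rightarrow> ('k, 'v, 'l) module_scheme \<Rightarrow> nat \<Rightarrow> (nat \<Rightarrow> 'v) \<Rightarrow> bool" where
  "independent_family K M n b \<longleftrightarrow> (\<forall>k<n. b k \<in> carrier M) \<and>
     inj_on (\<lambda>c. \<Oplus>\<^bsub>M\<^esub>k\<in>{..<n}. c k \<odot>\<^bsub>M\<^esub> b k) ({..<n} \<rightarrow>\<^sub>E carrier K)"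

lemma (in module) independent_family_extend:
  assumes "field R" and b: "independent_family R M n b" and x: "x \<in> carrier M"
    and notin: "x \<notin> (\<lambda>c. \<Oplus>\<^bsub>M\<^esub>k\<in>{..<n}. c k \<odot>\<^bsub>M\<^esub> b k) ` ({..<n} \<rightarrow>\<^sub>E carrier R)"
  shows "independent_family R M (Suc n) (b(n := x))"
proof -
  interpret F: field R by fact
  have bM: "\<And>k. k < n \<Longrightarrow> b k \<in> carrier M"
    and inj: "inj_on (\<lambda>c. \<Oplus>\<^bsub>M\<^esub>k\<in>{..<n}. c k \<odot>\<^bsub>M\<^esub> b k) ({..<n} \<rightarrow>\<^sub>E carrier R)"
    using b by (auto simp: independent_family_def)
  define S where "S c = (\<Oplus>\<^bsub>M\<^esub>k\<in>{..<n}. c k \<odot>\<^bsub>M\<^esub> b k)" for c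
  have S_restrict: "S (restrict c {..<n}) = S c" if "c \<in> {..<n} \<rightarrow> carrier R" for c
    unfolding S_def using that bM by (intro lincomb_cong) auto
  have expand: "(\<Oplus>\<^bsub>M\<^esub>k\<in>{..<Suc n}. c k \<odot>\<^bsub>M\<^esub> (b(n := x)) k) = c n \<odot>\<^bsub>M\<^esub> x \<oplus>\<^bsub>M\<^esub> S c"
    if c: "c \<in> {..<Suc n} \<rightarrow> carrier R" for c
  proof -
    have "(\<Oplus>\<^bsub>M\<^esub>k\<in>{..<n}. c k \<odot>\<^bsub>M\<^esub> (b(n := x)) k) = S c"
      unfolding S_def using c bM by (intro lincomb_cong) (auto simp: Pi_iff)
    moreover have "(b(n := x)) k \<in> carrier M" if "k < Suc n" for k
      using that bM x by (auto simp: less_Suc_eq)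
    ultimately show ?thesis
      using lincomb_Suc[OF c, of "b(n := x)"] by simp
  qed
  have "c = c'"
    if c: "c \<in> {..<Suc n} \<rightarrow>\<^sub>E carrier R" and c': "c' \<in> {..<Suc n} \<rightarrow>\<^sub>E carrier R"
      and eq: "c n \<odot>\<^bsub>M\<^esub> x \<oplus>\<^bsub>M\<^esub> S c = c' n \<odot>\<^bsub>M\<^esub> x \<oplus>\<^bsub>M\<^esub> S c'" for c c'
  proof -
    have cn: "c n \<in> carrier R" "c' n \<in> carrier R" using c c' by (auto simp: PiE_iff)
    have cP: "c \<in> {..<n} \<rightarrow> carrier R" "c' \<in> {..<n} \<rightarrow> carrier R" using c c' by (auto simp: PiE_iff)
    have SM: "S c \<in> carrier M" "S c' \<in> carrier M"
      unfolding S_def using lincomb_closed bM cP by blast+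
    have "c n = c' n"
    proof (rule ccontr)
      assume ne: "c n \<noteq> c' n"
      define a where "a = c n \<ominus> c' n"
      have a: "a \<in> carrier R" "a \<noteq> \<zero>" unfolding a_def using ne cn by auto
      then have aU: "a \<in> Units R" using F.field_Units by blast
      \<comment> \<open>Solving the relation for \<open>x\<close> puts \<open>x\<close> into the span of \<open>b\<close>.\<close>
      define u where "u = inv a"
      have u: "u \<in> carrier R" "u \<otimes> a = \<one>" unfolding u_def using aU by auto
      have "a \<odot>\<^bsub>M\<^esub> x = c n \<odot>\<^bsub>M\<^esub> x \<oplus>\<^bsub>M\<^esub> \<ominus>\<^bsub>M\<^esub> (c' n \<odot>\<^bsub>M\<^esub> x)"
        unfolding a_def a_minus_def using cn x by (simp add: smult_l_distr smult_l_minus)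
      also have "\<dots> = (c n \<odot>\<^bsub>M\<^esub> x \<oplus>\<^bsub>M\<^esub> S c) \<oplus>\<^bsub>M\<^esub> (\<ominus>\<^bsub>M\<^esub> S c \<oplus>\<^bsub>M\<^esub> \<ominus>\<^bsub>M\<^esub> (c' n \<odot>\<^bsub>M\<^esub> x))"
        using cn x SM by (simp add: M.a_assoc M.r_neg2)
      also have "\<dots> = S c' \<oplus>\<^bsub>M\<^esub> \<ominus>\<^bsub>M\<^esub> S c"
        unfolding eq using cn x SM
        by (simp add: M.a_assoc M.a_lcomm[of "c' n \<odot>\<^bsub>M\<^esub> x"] M.r_neg)
      finally have "a \<odot>\<^bsub>M\<^esub> x = S c' \<oplus>\<^bsub>M\<^esub> \<ominus>\<^bsub>M\<^esub> S c" .
      then have "u \<odot>\<^bsub>M\<^esub> (a \<odot>\<^bsub>M\<^esub> x) = u \<odot>\<^bsub>M\<^esub> S c' \<oplus>\<^bsub>M\<^esub> (\<ominus> u) \<odot>\<^bsub>M\<^esub> S c"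
        using u SM by (simp add: smult_r_distr smult_r_minus smult_l_minus)
      then have "x = u \<odot>\<^bsub>M\<^esub> S c' \<oplus>\<^bsub>M\<^esub> (\<ominus> u) \<odot>\<^bsub>M\<^esub> S c"
        using u a x by (simp add: smult_assoc1[symmetric])
      also have "\<dots> = S (\<lambda>k. u \<otimes> c' k \<oplus> (\<ominus> u) \<otimes> c k)"
        unfolding S_def using u cP bM by (intro lincomb_linear) auto
      also have "\<dots> = S (restrict (\<lambda>k. u \<otimes> c' k \<oplus> (\<ominus> u) \<otimes> c k) {..<n})"
        using u cP by (subst S_restrict) (auto simp: Pi_iff)
      finally have "x = S (restrict (\<lambda>k. u \<otimes> c' k \<oplus> (\<ominus> u) \<otimes> c k) {..<n})" .
      moreover have "restrict (\<lambda>k. u \<otimes> c' k \<oplus> (\<ominus> u) \<otimes> c k) {..<n} \<in> {..<n} \<rightarrow>\<^sub>E carrier R"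
        using u cP by (auto simp: Pi_iff)
      ultimately show False using notin unfolding S_def by blast
    qed
    moreover have "S c = S c'"
      using eq SM cn x \<open>c n = c' n\<close> by simp
    then have "S (restrict c {..<n}) = S (restrict c' {..<n})" using S_restrict cP by simp
    then have r: "restrict c {..<n} = restrict c' {..<n}"
      using inj cP unfolding S_def inj_on_def by (auto simp: PiE_iff Pi_iff)
    ultimately show ?thesis
      using c c' by (intro PiE_ext[OF c c']) (metis lessThan_iff less_Suc_eq restrict_apply')
  qed
  then have "inj_on (\<lambda>c. \<Oplus>\<^bsub>M\<^esub>k\<in>{..<Suc n}. c k \<odot>\<^bsub>M\<^esub> (b(n := x)) k) ({..<Suc n} \<rightarrow>\<^sub>E carrier R)"
    using expand by (intro inj_onI) (simp add: PiE_def)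
  then show ?thesis using bM x by (auto simp: independent_family_def less_Suc_eq)
qed

lemma (in field) card_carrier_ge_2:
  "finite (carrier R) \<Longrightarrow> 2 \<le> card (carrier R)"
  using card_mono[of "carrier R" "{\<zero>, \<one>}"] by simp

text \<open>
  An independent family of maximal length spans: otherwise it could be extended by a vector outside
  its span. The length is bounded because a family of length \<open>n\<close> produces at least \<open>2\<^sup>n\<close> vectors.
\<close>

lemma (in module) has_vs_dim_exists:
  assumes "field R" "finite (carrier R)" "finite (carrier M)"
  shows "\<exists>n. has_vs_dim R M n"
proof -
  interpret F: field R by fact
  let ?P = "\<lambda>n. \<exists>b. independent_family R M n b"
  have "inj_on (\<lambda>c. \<Oplus>\<^bsub>M\<^esub>k\<in>{..<0::nat}. c k \<odot>\<^bsub>M\<^esub> (undefined k)) ({..<0} \<rightarrow>\<^sub>E carrier R)"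
    by (simp add: inj_on_def)
  then have P0: "?P 0" unfolding independent_family_def by (intro exI[of _ undefined]) simp
  have bound: "n \<le> card (carrier M)" if Pn: "?P n" for n
  proof -
    obtain b where b: "independent_family R M n b" using Pn by blast
    have "(\<lambda>c. \<Oplus>\<^bsub>M\<^esub>k\<in>{..<n}. c k \<odot>\<^bsub>M\<^esub> b k) ` ({..<n} \<rightarrow>\<^sub>E carrier R) \<subseteq> carrier M"
      using b lincomb_closed[of _ n b] by (auto simp: independent_family_def PiE_def)
    then have "card ({..<n} \<rightarrow>\<^sub>E carrier R) \<le> card (carrier M)"
      using b assms(3) by (auto simp: independent_family_def intro: card_inj_on_le)
    moreover have "card ({..<n} \<rightarrow>\<^sub>E carrier R) = card (carrier R) ^ n"
      by (simp add: card_PiE)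
    moreover have "2 ^ n \<le> card (carrier R) ^ n"
      using F.card_carrier_ge_2[OF assms(2)] by (intro power_mono) auto
    ultimately show ?thesis using less_exp[of n] by linarith
  qed
  obtain n where n: "?P n" "\<And>m. ?P m \<Longrightarrow> m \<le> n"
    using GreatestI_nat[of ?P 0 "card (carrier M)"] Greatest_le_nat[of ?P _ "card (carrier M)"]
      P0 bound by blast
  then obtain b where b: "independent_family R M n b" by blast
  let ?S = "\<lambda>c. \<Oplus>\<^bsub>M\<^esub>k\<in>{..<n}. c k \<odot>\<^bsub>M\<^esub> b k"
  have "carrier M \<subseteq> ?S ` ({..<n} \<rightarrow>\<^sub>E carrier R)"
  proof
    fix x assume "x \<in> carrier M"
    show "x \<in> ?S ` ({..<n} \<rightarrow>\<^sub>E carrier R)"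
    proof (rule ccontr)
      assume "x \<notin> ?S ` ({..<n} \<rightarrow>\<^sub>E carrier R)"
      then have "?P (Suc n)"
        using independent_family_extend[OF assms(1) b \<open>x \<in> carrier M\<close>] by blast
      then show False using n(2) by fastforce
    qed
  qed
  moreover have "?S ` ({..<n} \<rightarrow>\<^sub>E carrier R) \<subseteq> carrier M"
    using b lincomb_closed[of _ n b] by (auto simp: independent_family_def PiE_def)
  ultimately show ?thesis
    using b unfolding has_vs_dim_def independent_family_def bij_betw_def by blast
qed

lemma has_vs_dim_card:
  assumes "has_vs_dim K M n"
  shows "card (carrier M) = card (carrier K) ^ n"
    and "finite (carrier K) \<Longrightarrow> finite (carrier M)"
proof -
  obtain b where b: "bij_betw (\<lambda>c. \<Oplus>\<^bsub>M\<^esub>k\<in>{..<n}. c k \<odot>\<^bsub>M\<^esub> b k) ({..<n} \<rightarrow>\<^sub>E carrier K) (carrier M)"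
    using assms by (auto simp: has_vs_dim_def)
  show "card (carrier M) = card (carrier K) ^ n"
    using bij_betw_same_card[OF b] by (simp add: card_PiE)
  show "finite (carrier K) \<Longrightarrow> finite (carrier M)"
    using bij_betw_finite[OF b] by (simp add: finite_PiE)
qed

text \<open>
  Counting vectors makes the dimension unique, so \<open>vs_dim\<close> is determined by the cardinality.
\<close>

lemma card_eq_vs_dim:
  assumes "field K" "module K M" "finite (carrier K)" "finite (carrier M)"
  shows "card (carrier M) = card (carrier K) ^ vs_dim K M"
proof -
  obtain n where n: "has_vs_dim K M n"
    using module.has_vs_dim_exists[OF assms(2,1,3,4)] by blast
  have "m = n" if "has_vs_dim K M m" for m
    using has_vs_dim_card(1)[OF that] has_vs_dim_card(1)[OF n]
      field.card_carrier_ge_2[OF assms(1,3)] by (simp add: power_inject_exp)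
  then have "vs_dim K M = n" unfolding vs_dim_def using n by blast
  then show ?thesis using has_vs_dim_card(1)[OF n] by simp
qed

lemma submodule_vs_dim_eq_0_iff:
  assumes K: "field K" "finite (carrier K)" and M: "module K M" "finite (carrier M)"
    and W: "submodule W K M"
  shows "vs_dim K (M\<lparr>carrier := W\<rparr>) = 0 \<longleftrightarrow> W = {\<zero>\<^bsub>M\<^esub>}"
proof -
  have mod: "module K (M\<lparr>carrier := W\<rparr>)" using submodule.submodule_is_module[OF W M(1)] .
  have fin: "finite W" using module.submoduleE(1)[OF M(1) W] M(2) finite_subset by blast
  have card: "card W = card (carrier K) ^ vs_dim K (M\<lparr>carrier := W\<rparr>)"
    using card_eq_vs_dim[OF K(1) mod K(2)] fin by simp
  have zero: "\<zero>\<^bsub>M\<^esub> \<in> W"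
    using subgroup.one_closed[OF submodule.axioms(1)[OF W]] by simp
  have "vs_dim K (M\<lparr>carrier := W\<rparr>) = 0 \<longleftrightarrow> card W = 1"
    using card field.card_carrier_ge_2[OF K] by (auto simp: power_eq_1_iff)
  also have "\<dots> \<longleftrightarrow> W = {\<zero>\<^bsub>M\<^esub>}" using zero by (auto simp: card_1_singleton_iff)
  finally show ?thesis .
qed

section \<open>Grassmannians of representations over a finite field\<close>

locale finite_valued_rep =
  fixes L :: "'k ring" and F :: "'k set" and B :: "('n::finite) int_mat" and d :: "'n \<Rightarrow> nat"
    and V :: "('n, 'k, 'v) valued_rep"
  assumes closure: "algebraic_closure L F" and finite_F: "finite F" and d_pos: "\<And>i. 0 < d i"
    and rep: "valued_representation L F B d V"
begin

lemma degree_field_finite: "field (degree_field L F (d i))" "finite (carrier (degree_field L F (d i)))"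
proof -
  have "ring L" using closure by (simp add: algebraic_closure_def field_def domain_def cring_def)
  then show "field (degree_field L F (d i))"
    using finite_degree_extension(1)[OF closure finite_F d_pos] by (rule ring.subfield_iff(2))
  show "finite (carrier (degree_field L F (d i)))"
    using finite_degree_extension(2)[OF closure finite_F d_pos] by simp
qed

lemma space_module: "module (degree_field L F (d i)) (rep_space V i)"
  using rep[unfolded valued_representation_def, THEN conjunct1, rule_format, of i] by simp

lemma space_finite: "finite (carrier (rep_space V i))"
proof -
  obtain n where "has_vs_dim (degree_field L F (d i)) (rep_space V i) n"
    using rep[unfolded valued_representation_def, THEN conjunct1, rule_format, of i] by auto
  then show ?thesis using degree_field_finite(2) by (rule has_vs_dim_card(2))
qed

lemma subobject_submodule:
  "subobject L F B d V W \<Longrightarrow> submodule (W i) (degree_field L F (d i)) (rep_space V i)"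
  by (simp add: subobject_def)

lemma subobject_subset: "subobject L F B d V W \<Longrightarrow> W i \<subseteq> carrier (rep_space V i)"
  using module.submoduleE(1)[OF space_module subobject_submodule] .

text \<open>
  The cluster character sums over this set, and a sum over an infinite set would be zero.
\<close>

lemma finite_nonempty_Gr: "finite {e. quiver_Gr L F B d V e \<noteq> {}}"
proof -
  have "{W. subobject L F B d V W} \<subseteq> (\<Pi>\<^sub>E i\<in>UNIV. Pow (carrier (rep_space V i)))"
    by (intro subsetI) (simp add: PiE_iff subobject_subset)
  then have "finite {W. subobject L F B d V W}"
    by (rule finite_subset) (intro finite_PiE, simp_all add: space_finite)
  moreover have "{e. quiver_Gr L F B d V e \<noteq> {}} \<subseteq> dim_vector L F d V ` {W. subobject L F B d V W}"
    by (auto simp: quiver_Gr_def)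
  ultimately show ?thesis using finite_subset by blast
qed

lemma nonempty_Gr_nonneg: "quiver_Gr L F B d V e \<noteq> {} \<Longrightarrow> 0 \<le> e $ i"
  by (auto simp: quiver_Gr_def dim_vector_def)

lemma subobject_zero: "subobject L F B d V (\<lambda>i. {\<zero>\<^bsub>rep_space V i\<^esub>})"
  unfolding subobject_def
proof (intro conjI allI ballI)
  fix i
  interpret module "degree_field L F (d i)" "rep_space V i" using space_module .
  show "submodule {\<zero>\<^bsub>rep_space V i\<^esub>} (degree_field L F (d i)) (rep_space V i)"
    by (rule submoduleI) auto
next
  fix p assume p: "p \<in> arrows B"
  obtain i j a where ija: "p = (i, j, a)" by (cases p)
  interpret Mi: module "degree_field L F (d i)" "rep_space V i" using space_module .
  interpret Mj: module "degree_field L F (d j)" "rep_space V j" using space_module .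
  let ?f = "rep_map V i j a"
  have lin: "linear_over (degree_extension L F (gcd (d i) (d j))) (rep_space V i) (rep_space V j) ?f"
    using rep[unfolded valued_representation_def, THEN conjunct2, rule_format, OF p]
    by (simp add: ija)
  have c: "?f \<zero>\<^bsub>rep_space V i\<^esub> \<in> carrier (rep_space V j)"
    using lin Mi.zero_closed unfolding linear_over_def by blast
  have "?f (\<zero>\<^bsub>rep_space V i\<^esub> \<oplus>\<^bsub>rep_space V i\<^esub> \<zero>\<^bsub>rep_space V i\<^esub>) =
      ?f \<zero>\<^bsub>rep_space V i\<^esub> \<oplus>\<^bsub>rep_space V j\<^esub> ?f \<zero>\<^bsub>rep_space V i\<^esub>"
    using lin Mi.zero_closed unfolding linear_over_def by blast
  then have "?f \<zero>\<^bsub>rep_space V i\<^esub> = \<zero>\<^bsub>rep_space V j\<^esub>" using c by simp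
  then show "case p of (i, j, a) \<Rightarrow>
      rep_map V i j a ` {\<zero>\<^bsub>rep_space V i\<^esub>} \<subseteq> {\<zero>\<^bsub>rep_space V j\<^esub>}"
    by (simp add: ija)
qed

text \<open>
  Responsible for the constant term \<open>1\<close> of the F-factor.
\<close>

lemma Gr_zero: "quiver_Gr L F B d V 0 = {\<lambda>i. {\<zero>\<^bsub>rep_space V i\<^esub>}}"
proof -
  have "dim_vector L F d V W = 0 \<longleftrightarrow> W = (\<lambda>i. {\<zero>\<^bsub>rep_space V i\<^esub>})" if W: "subobject L F B d V W" for W
  proof -
    have "vs_dim (degree_field L F (d i)) ((rep_space V i)\<lparr>carrier := W i\<rparr>) = 0 \<longleftrightarrow>
        W i = {\<zero>\<^bsub>rep_space V i\<^esub>}" for i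
      using submodule_vs_dim_eq_0_iff[OF degree_field_finite space_module space_finite
          subobject_submodule[OF W]] .
    then show ?thesis by (auto simp: dim_vector_def vec_eq_iff fun_eq_iff)
  qed
  then show ?thesis using subobject_zero by (auto simp: quiver_Gr_def)
qed

end

section \<open>The Euler form\<close>

lemma invertible_valued_quiver_skew:
  assumes "invertible_valued_quiver B d"
  shows "int (d i) * B $ i $ k = - (int (d k) * B $ k $ i)"
proof -
  have entry: "(diag_matrix d ** rat_matrix B) $ a $ b = of_int (int (d a) * B $ a $ b)" for a b
    by (simp add: matrix_matrix_mult_def diag_matrix_def rat_matrix_def if_distrib if_distribR
        sum.delta cong: if_cong)
  have "(diag_matrix d ** rat_matrix B) $ i $ k = - (diag_matrix d ** rat_matrix B) $ k $ i"
    using assms unfolding invertible_valued_quiver_def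
    by (metis (no_types, lifting) transpose_def vec_lambda_beta vector_uminus_component)
  then have "(of_int (int (d i) * B $ i $ k) :: rat) = of_int (- (int (d k) * B $ k $ i))"
    unfolding entry by simp
  then show ?thesis by (simp only: of_int_eq_iff)
qed

lemma euler_form_diagonal:
  assumes "invertible_valued_quiver B d"
  shows "2 * euler_form B d e e =
    (\<Sum>i\<in>UNIV. \<Sum>k\<in>UNIV. int (d i) * cartan_counterpart B $ i $ k * e $ i * e $ k)"
proof -
  define h where "h i k = (if i = k then int (d i) else - max 0 (int (d i) * B $ i $ k))" for i k
  have h: "h i k + h k i = int (d i) * cartan_counterpart B $ i $ k" for i k
  proof (cases "i = k")
    case False
    have "max 0 (int (d i) * B $ i $ k) + max 0 (int (d k) * B $ k $ i) = \<bar>int (d i) * B $ i $ k\<bar>"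
      unfolding invertible_valued_quiver_skew[OF assms, of i k] by (simp add: max_def)
    then show ?thesis using False by (simp add: h_def cartan_counterpart_def abs_mult)
  qed (simp add: h_def cartan_counterpart_def)
  have E: "euler_form B d e e = (\<Sum>i\<in>UNIV. \<Sum>k\<in>UNIV. e $ i * e $ k * h i k)"
    by (simp add: euler_form_def h_def)
  have "euler_form B d e e = (\<Sum>i\<in>UNIV. \<Sum>k\<in>UNIV. e $ i * e $ k * h k i)"
    unfolding E by (subst sum.swap) (simp add: mult.commute)
  then have "2 * euler_form B d e e = (\<Sum>i\<in>UNIV. \<Sum>k\<in>UNIV. e $ i * e $ k * (h i k + h k i))"
    using E by (simp add: sum.distrib distrib_left)
  then show ?thesis unfolding h by (simp add: ac_simps)
qed

text \<open>
  Twice the Euler form on the diagonal is the quadratic form of \<open>DC\<close>, where \<open>C\<close> is the Cartan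
  counterpart. Finite type provides some positive symmetrizer \<open>s\<close> of \<open>C\<close> with \<open>sC\<close> positive
  definite, which need not be \<open>d\<close>. But \<open>t\<^sub>i = d\<^sub>i / s\<^sub>i\<close> is constant on the connected components of \<open>C\<close>, so
  the substitution \<open>x\<^sub>i = \<surd>t\<^sub>i e\<^sub>i\<close> turns one form into the other.
\<close>

lemma euler_form_pos:
  fixes B :: "('n::finite) int_mat"
  assumes Q: "invertible_valued_quiver B d" and ft: "of_finite_type B" and e: "e \<noteq> 0"
  shows "0 < euler_form B d e e"
proof -
  let ?C = "cartan_counterpart B"
  have "\<exists>s::'n \<Rightarrow> real. (\<forall>i. 0 < s i) \<and>
      (\<forall>i k. s i * of_int (?C $ i $ k) = s k * of_int (?C $ k $ i)) \<and>
      (\<forall>x::real^'n. x \<noteq> 0 \<longrightarrow>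
        0 < (\<Sum>i\<in>UNIV. \<Sum>k\<in>UNIV. s i * of_int (?C $ i $ k) * x $ i * x $ k))"
    using ft unfolding of_finite_type_def cartan_matrix_of_finite_type_def by (elim conjE)
  then obtain s :: "'n \<Rightarrow> real" where *: "(\<forall>i. 0 < s i) \<and>
      (\<forall>i k. s i * of_int (?C $ i $ k) = s k * of_int (?C $ k $ i)) \<and>
      (\<forall>x::real^'n. x \<noteq> 0 \<longrightarrow>
        0 < (\<Sum>i\<in>UNIV. \<Sum>k\<in>UNIV. s i * of_int (?C $ i $ k) * x $ i * x $ k))"
    by (rule exE)
  note s = *[THEN conjunct1, rule_format] *[THEN conjunct2, THEN conjunct1, rule_format]
    *[THEN conjunct2, THEN conjunct2, rule_format]
  have d: "0 < d i" for i using Q by (simp add: invertible_valued_quiver_def)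
  have symd: "real (d i) * of_int (?C $ i $ k) = real (d k) * of_int (?C $ k $ i)" for i k
  proof -
    have "int (d i) * \<bar>B $ i $ k\<bar> = int (d k) * \<bar>B $ k $ i\<bar>"
      using arg_cong[OF invertible_valued_quiver_skew[OF Q, of i k], of abs] by (simp add: abs_mult)
    then have "int (d i) * ?C $ i $ k = int (d k) * ?C $ k $ i"
      by (auto simp: cartan_counterpart_def)
    then have "real_of_int (int (d i) * ?C $ i $ k) = real_of_int (int (d k) * ?C $ k $ i)" by simp
    then show ?thesis by simp
  qed
  define t where "t i = real (d i) / s i" for i
  have t_pos: "0 < t i" for i unfolding t_def using d s(1) by simp
  have t_eq: "t i = t k" if "?C $ i $ k \<noteq> 0" for i k
  proof -
    have c: "of_int (?C $ i $ k) \<noteq> (0::real)" using that by simp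
    have "?C $ k $ i \<noteq> 0" using s(2)[of i k] c s(1)[of i] by auto
    then have c': "of_int (?C $ k $ i) \<noteq> (0::real)" by simp
    have "real (d i) * of_int (?C $ i $ k) * (s k * of_int (?C $ k $ i)) =
        real (d k) * of_int (?C $ k $ i) * (s i * of_int (?C $ i $ k))"
      using symd[of i k] s(2)[of i k] by simp
    then have "real (d i) * s k = real (d k) * s i" using c c' by simp
    then show ?thesis unfolding t_def using s(1)[of i] s(1)[of k] by (simp add: field_simps)
  qed
  define x :: "real^'n" where "x = (\<chi> i. sqrt (t i) * of_int (e $ i))"
  have "x \<noteq> 0"
  proof -
    obtain i where "e $ i \<noteq> 0" using e by (auto simp: vec_eq_iff)
    then have "x $ i \<noteq> 0" unfolding x_def using t_pos[of i] by simp
    then show ?thesis by auto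
  qed
  have summand: "s i * of_int (?C $ i $ k) * x $ i * x $ k =
      of_int (int (d i) * ?C $ i $ k * e $ i * e $ k)" for i k
  proof (cases "?C $ i $ k = 0")
    case False
    have "sqrt (t i) * sqrt (t k) = t i" using t_eq[OF False] t_pos[of k] by simp
    then have "s i * of_int (?C $ i $ k) * x $ i * x $ k =
        s i * t i * of_int (?C $ i $ k) * of_int (e $ i) * of_int (e $ k)"
      unfolding x_def by (simp add: algebra_simps)
    then show ?thesis unfolding t_def using s(1)[of i] by simp
  qed simp
  have "0 < (\<Sum>i\<in>UNIV. \<Sum>k\<in>UNIV. s i * of_int (?C $ i $ k) * x $ i * x $ k)"
    using s(3) \<open>x \<noteq> 0\<close> .
  also have "\<dots> = of_int (2 * euler_form B d e e)"
    unfolding summand euler_form_diagonal[OF Q] by simp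
  finally show ?thesis by simp
qed

lemma euler_form_diff_right: "euler_form B d e (f - g) = euler_form B d e f - euler_form B d e g"
  by (simp add: euler_form_def algebra_simps sum_subtractf)

lemma euler_form_basis:
  "euler_form B d (axis i 1) f =
    (\<Sum>k\<in>UNIV. f $ k * (if i = k then int (d i) else - max 0 (int (d i) * B $ i $ k)))"
proof -
  have "euler_form B d (axis i 1) f = (\<Sum>l\<in>UNIV. if l = i then
      (\<Sum>k\<in>UNIV. f $ k * (if i = k then int (d i) else - max 0 (int (d i) * B $ i $ k))) else 0)"
    unfolding euler_form_def by (rule sum.cong) (auto simp: axis_def)
  then show ?thesis by (simp add: sum.delta)
qed

lemma euler_form_expand_left:
  "euler_form B d e f = (\<Sum>i\<in>UNIV. e $ i * euler_form B d (axis i 1) f)"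
  unfolding euler_form_basis by (simp add: euler_form_def sum_distrib_left mult.assoc)

lemma left_star_mult:
  assumes "0 < d i"
  shows "int (d i) * left_star B d f $ i = euler_form B d (axis i 1) f"
proof -
  have "int (d i) dvd - max 0 (int (d i) * B $ i $ k)" for k
    by (simp add: max_def)
  then have "int (d i) dvd euler_form B d (axis i 1) f"
    unfolding euler_form_basis by (intro dvd_sum dvd_mult) auto
  then show ?thesis by (simp add: left_star_def)
qed

section \<open>The skew-symmetric forms of the two tori\<close>

text \<open>
  The bilinear form \<open>a\<^sup>T M b\<close>, which for skew-symmetric \<open>M\<close> governs the commutation
  \<open>X\<^bsup>(a)\<^esup> X\<^bsup>(b)\<^esup> = q\<^bsup>M(a, b)\<^esup> X\<^bsup>(b)\<^esup> X\<^bsup>(a)\<^esup>\<close>.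
\<close>

definition torus_form :: "('n::finite) rat_mat \<Rightarrow> 'n int_vec \<Rightarrow> 'n int_vec \<Rightarrow> rat" where
  "torus_form M a b = (\<Sum>i\<in>UNIV. \<Sum>k\<in>UNIV. M $ i $ k * of_int (a $ i * b $ k))"

definition normal_exp :: "('n::{finite,linorder}) rat_mat \<Rightarrow> 'n int_vec \<Rightarrow> rat" where
  "normal_exp M a = - (1/2) * (\<Sum>(i, k)\<in>{(i, k). i < k}. M $ i $ k * of_int (a $ i * a $ k))"

text \<open>
  The exponent identity behind \<open>X\<^bsup>(a)\<^esup> X\<^bsup>(b)\<^esup> = q\<^bsup>M(a, b)/2\<^esup> X\<^bsup>(a + b)\<^esup>\<close>: the normalization of the ordered
  monomials distributes the reordering factor evenly between the two orders of multiplication.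
\<close>

lemma normal_exp_add:
  fixes M :: "('n::{finite,linorder}) rat_mat"
  assumes "transpose M = - M"
  shows "normal_exp M (a + b) = - (1/2) * torus_form M a b + (reorder_exp M a b + (normal_exp M a + normal_exp M b))"
proof -
  have skew: "M $ i $ k = - M $ k $ i" for i k
    using assms by (metis (no_types, lifting) transpose_def vec_lambda_beta vector_uminus_component)
  define f where "f = (\<lambda>(i, k). M $ i $ k * of_int (a $ i * b $ k))"
  let ?U = "{(i, k). i < k} :: ('n \<times> 'n) set" and ?L = "{(i, k). k < i} :: ('n \<times> 'n) set"
  let ?D = "{(i, k). i = k} :: ('n \<times> 'n) set"
  have "M $ i $ i = 0" for i using skew[of i i] by simp
  then have diag: "sum f ?D = 0" by (intro sum.neutral) (auto simp: f_def)
  have "torus_form M a b = sum f (UNIV \<times> UNIV)"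
    unfolding torus_form_def f_def sum.cartesian_product by simp
  also have "UNIV \<times> UNIV = ?U \<union> (?L \<union> ?D)" by auto
  also have "sum f \<dots> = sum f ?U + (sum f ?L + sum f ?D)"
    by (subst sum.union_disjoint, auto)+
  finally have form: "torus_form M a b = sum f ?U + sum f ?L" using diag by simp
  have reorder: "reorder_exp M a b = sum f ?L" unfolding reorder_exp_def f_def ..
  have ba: "(\<Sum>(i, k)\<in>?U. M $ i $ k * of_int (b $ i * a $ k)) = - sum f ?L"
  proof -
    have "sum f ?L = (\<Sum>(i, k)\<in>?U. f (k, i))"
      by (rule sum.reindex_bij_witness[of _ prod.swap prod.swap]) auto
    also have "\<dots> = (\<Sum>(i, k)\<in>?U. - (M $ i $ k * of_int (b $ i * a $ k)))"
    proof (rule sum.cong, simp, clarify)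
      fix i k :: 'n
      show "f (k, i) = - (M $ i $ k * of_int (b $ i * a $ k))"
        using skew[of k i] by (simp add: f_def)
    qed
    finally show ?thesis by (simp add: case_prod_unfold sum_negf)
  qed
  have expand: "(\<Sum>(i, k)\<in>?U. M $ i $ k * of_int ((a + b) $ i * (a + b) $ k)) =
      (\<Sum>(i, k)\<in>?U. M $ i $ k * of_int (a $ i * a $ k)) + sum f ?U +
      (\<Sum>(i, k)\<in>?U. M $ i $ k * of_int (b $ i * a $ k)) +
      (\<Sum>(i, k)\<in>?U. M $ i $ k * of_int (b $ i * b $ k))"
    unfolding sum.distrib[symmetric] f_def by (intro sum.cong refl) (auto simp: algebra_simps)
  have halves: "- (1/2) * x = - (1/2) * (u + v) + (v + (- (1/2) * y + - (1/2) * w))"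
    if "z = - v" and "x = y + u + z + w" for x y z u v w :: rat
    using that by (simp add: field_simps)
  show ?thesis
    unfolding form reorder normal_exp_def by (rule halves[OF ba expand])
qed

lemma normal_exp_axis: "normal_exp M (axis i 1) = 0"
  unfolding normal_exp_def by (subst sum.neutral) (auto simp: axis_def)

lemma DB_matrix_entry: "DB_matrix B d $ i $ k = of_int (int (d i) * B $ i $ k)"
  by (simp add: DB_matrix_def matrix_matrix_mult_def diag_matrix_def rat_matrix_def if_distrib
      if_distribR sum.delta cong: if_cong)

lemma Lambda_matrix_entry:
  "Lambda_matrix B d $ i $ k = - (of_nat (d i) * matrix_inv (rat_matrix B) $ i $ k)"
  by (simp add: Lambda_matrix_def matrix_matrix_mult_def diag_matrix_def if_distrib
      if_distribR sum.delta cong: if_cong)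

lemma DB_matrix_skew:
  "invertible_valued_quiver B d \<Longrightarrow> transpose (DB_matrix B d) = - DB_matrix B d"
  by (simp add: invertible_valued_quiver_def DB_matrix_def)

lemma rat_matrix_inverse:
  assumes "invertible_valued_quiver B d"
  shows "(\<Sum>k\<in>UNIV. of_int (B $ i $ k) * matrix_inv (rat_matrix B) $ k $ l) = (if i = l then 1 else 0)"
proof -
  have "rat_matrix B ** matrix_inv (rat_matrix B) = mat 1"
    using assms someI_ex[of "\<lambda>A. rat_matrix B ** A = mat 1 \<and> A ** rat_matrix B = mat 1"]
    unfolding matrix_inv_def invertible_valued_quiver_def invertible_def by blast
  then have "(rat_matrix B ** matrix_inv (rat_matrix B)) $ i $ l = mat 1 $ i $ l" by simp
  then show ?thesis by (simp add: matrix_matrix_mult_def rat_matrix_def mat_def)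
qed

text \<open>
  The compatibility \<open>B\<^sup>T \<Lambda> = D\<close>, which follows from \<open>B\<^sup>T D = -DB\<close> and \<open>\<Lambda> = -DB\<^sup>-\<^sup>1\<close>. The
  computations in the torus of \<open>\<Lambda>\<close> reduce to it.
\<close>

lemma Lambda_matrix_column:
  assumes Q: "invertible_valued_quiver B d"
  shows "(\<Sum>i\<in>UNIV. of_int (B $ i $ k) * Lambda_matrix B d $ i $ l) =
    (if k = l then of_nat (d k) else 0)"
proof -
  let ?I = "matrix_inv (rat_matrix B)"
  have skew: "(of_nat (d i) :: rat) * of_int (B $ i $ k) = - (of_nat (d k) * of_int (B $ k $ i))" for i
    using arg_cong[OF invertible_valued_quiver_skew[OF Q, of i k], of "of_int :: int \<Rightarrow> rat"] by simp
  have "(\<Sum>i\<in>UNIV. of_int (B $ i $ k) * Lambda_matrix B d $ i $ l) =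
      (\<Sum>i\<in>UNIV. of_nat (d k) * (of_int (B $ k $ i) * ?I $ i $ l))"
  proof (rule sum.cong)
    fix i
    have "of_int (B $ i $ k) * Lambda_matrix B d $ i $ l =
        - (of_nat (d i) * of_int (B $ i $ k)) * ?I $ i $ l"
      by (simp add: Lambda_matrix_entry)
    then show "of_int (B $ i $ k) * Lambda_matrix B d $ i $ l =
        of_nat (d k) * (of_int (B $ k $ i) * ?I $ i $ l)"
      unfolding skew by simp
  qed simp
  also have "\<dots> = of_nat (d k) * (if k = l then 1 else 0)"
    unfolding sum_distrib_left[symmetric] rat_matrix_inverse[OF Q] ..
  finally show ?thesis by simp
qed

lemma Lambda_matrix_skew:
  assumes Q: "invertible_valued_quiver B d"
  shows "transpose (Lambda_matrix B d) = - Lambda_matrix B d"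
proof -
  let ?I = "matrix_inv (rat_matrix B)" and ?M = "Lambda_matrix B d"
  have neg: "?M $ l $ m = - ?M $ m $ l" for l m
  proof -
    \<comment> \<open>Evaluate \<open>(B\<^sup>-\<^sup>1)\<^sup>T B\<^sup>T \<Lambda>\<close> in its two bracketings: \<open>(B\<^sup>-\<^sup>1)\<^sup>T D = -\<Lambda>\<^sup>T\<close> and \<open>\<Lambda>\<close>.\<close>
    have "(\<Sum>i\<in>UNIV. \<Sum>k\<in>UNIV. ?I $ k $ m * of_int (B $ i $ k) * ?M $ i $ l) =
        (\<Sum>k\<in>UNIV. ?I $ k $ m * (\<Sum>i\<in>UNIV. of_int (B $ i $ k) * ?M $ i $ l))"
      by (subst sum.swap) (simp add: sum_distrib_left mult.assoc)
    also have "\<dots> = (\<Sum>k\<in>UNIV. if k = l then ?I $ k $ m * of_nat (d k) else 0)"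
      unfolding Lambda_matrix_column[OF Q] by (intro sum.cong) auto
    also have "\<dots> = - ?M $ l $ m"
      by (simp add: sum.delta Lambda_matrix_entry)
    finally have 1: "(\<Sum>i\<in>UNIV. \<Sum>k\<in>UNIV. ?I $ k $ m * of_int (B $ i $ k) * ?M $ i $ l) = - ?M $ l $ m" .
    have "(\<Sum>i\<in>UNIV. \<Sum>k\<in>UNIV. ?I $ k $ m * of_int (B $ i $ k) * ?M $ i $ l) =
        (\<Sum>i\<in>UNIV. (\<Sum>k\<in>UNIV. of_int (B $ i $ k) * ?I $ k $ m) * ?M $ i $ l)"
      unfolding sum_distrib_right by (intro sum.cong refl) (simp add: mult.commute)
    also have "\<dots> = (\<Sum>i\<in>UNIV. if i = m then ?M $ i $ l else 0)"
      unfolding rat_matrix_inverse[OF Q] by (intro sum.cong) auto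
    also have "\<dots> = ?M $ m $ l" by (simp add: sum.delta)
    finally show ?thesis using 1 by simp
  qed
  have "transpose ?M $ i $ k = (- ?M) $ i $ k" for i k
    using neg[of k i] by (simp add: transpose_def)
  then show ?thesis unfolding vec_eq_iff by blast
qed

lemma torus_form_Lambda:
  assumes Q: "invertible_valued_quiver B d"
  shows "torus_form (Lambda_matrix B d) (B *v e) w = (\<Sum>k\<in>UNIV. of_int (int (d k) * e $ k * w $ k))"
proof -
  let ?M = "Lambda_matrix B d"
  have "torus_form ?M (B *v e) w =
      (\<Sum>i\<in>UNIV. \<Sum>l\<in>UNIV. \<Sum>k\<in>UNIV. of_int (e $ k) * of_int (w $ l) * (of_int (B $ i $ k) * ?M $ i $ l))"
    by (simp add: torus_form_def matrix_vector_mult_def sum_distrib_left sum_distrib_right ac_simps)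
  also have "\<dots> = (\<Sum>k\<in>UNIV. \<Sum>l\<in>UNIV. \<Sum>i\<in>UNIV. of_int (e $ k) * of_int (w $ l) * (of_int (B $ i $ k) * ?M $ i $ l))"
  proof -
    have "(\<Sum>i\<in>UNIV. \<Sum>l\<in>UNIV. \<Sum>k\<in>UNIV. g i l k) = (\<Sum>k\<in>UNIV. \<Sum>l\<in>UNIV. \<Sum>i\<in>UNIV. g i l k)"
      for g :: "'a \<Rightarrow> 'a \<Rightarrow> 'a \<Rightarrow> rat"
      by (subst sum.swap, subst (2) sum.swap, subst (1) sum.swap, rule refl)
    then show ?thesis .
  qed
  also have "\<dots> = (\<Sum>k\<in>UNIV. \<Sum>l\<in>UNIV. of_int (e $ k) * of_int (w $ l) * (if k = l then of_nat (d k) else 0))"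
    unfolding sum_distrib_left[symmetric] Lambda_matrix_column[OF Q] ..
  also have "\<dots> = (\<Sum>k\<in>UNIV. of_int (int (d k) * e $ k * w $ k))"
    by (simp add: if_distrib sum.delta' ac_simps cong: if_cong)
  finally show ?thesis .
qed

lemma torus_form_DB_basis:
  "torus_form (DB_matrix B d) e (axis i 1) = (\<Sum>k\<in>UNIV. of_int (int (d k) * e $ k * B $ k $ i))"
proof -
  have "torus_form (DB_matrix B d) e (axis i 1) =
     (\<Sum>k\<in>UNIV. \<Sum>l\<in>UNIV. if l = i then of_int (int (d k) * e $ k * B $ k $ i) else 0)"
    unfolding torus_form_def DB_matrix_entry by (intro sum.cong) (auto simp: axis_def)
  then show ?thesis by (simp add: sum.delta)
qed

text \<open>
  The columns of \<open>B\<close> commute in the torus of \<open>\<Lambda>\<close> as the generators do in the torus of \<open>DB\<close>; this is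
  why \<open>Z\<^sub>i \<mapsto> X\<^bsup>(b\<^sup>i)\<^esup>\<close> respects the normalization of monomials.
\<close>

lemma torus_form_column:
  assumes "invertible_valued_quiver B d"
  shows "torus_form (Lambda_matrix B d) (B *v e) (column i B) = torus_form (DB_matrix B d) e (axis i 1)"
  unfolding torus_form_Lambda[OF assms] torus_form_DB_basis by (simp add: column_def)

text \<open>
  The source of the exponent in the F-factor: splitting \<open>X\<^bsup>(-*v)\<^esup>\<close> off \<open>X\<^bsup>(Be - *v)\<^esup>\<close> costs
  \<open>q\<close> to the power \<open>\<langle>e, v\<rangle>/2\<close>.
\<close>

lemma torus_form_left_star:
  assumes Q: "invertible_valued_quiver B d"
  shows "torus_form (Lambda_matrix B d) (B *v e) (- left_star B d v) = - of_int (euler_form B d e v)"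
proof -
  have d: "0 < d i" for i using Q by (simp add: invertible_valued_quiver_def)
  have "int (d k) * e $ k * (- left_star B d v) $ k = - (e $ k * euler_form B d (axis k 1) v)" for k
    unfolding left_star_mult[OF d, symmetric] by simp
  then show ?thesis
    unfolding torus_form_Lambda[OF Q] euler_form_expand_left[of B d e v]
    by (simp only: sum_negf of_int_sum of_int_minus)
qed

section \<open>Rings of scalars\<close>

lemma int_adjoin_power: "x \<in> int_adjoin S \<Longrightarrow> x ^ n \<in> int_adjoin S"
proof (induction n)
  case 0
  show ?case using int_adjoin.of_int[of 1 S] by simp
qed (simp add: int_adjoin.mult)

lemma int_adjoin_mono:
  assumes "S \<subseteq> int_adjoin T" shows "int_adjoin S \<subseteq> int_adjoin T"
proof
  fix x assume "x \<in> int_adjoin S"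
  then show "x \<in> int_adjoin T"
    by induction (use assms int_adjoin.intros in auto)
qed

lemma int_adjoin_zero: "0 \<in> int_adjoin S"
  using int_adjoin.of_int[of 0 S] by simp

lemma int_adjoin_of_nat: "real n \<in> int_adjoin S"
  using int_adjoin.of_int[of "int n" S] by simp

lemma powr_int_adjoin:
  assumes "q > 0" and "y = of_int m * r"
  shows "q powr y \<in> int_adjoin {q powr r, q powr - r}"
proof (cases "m \<ge> 0")
  case True
  then have "q powr y = (q powr r) ^ nat m"
    using assms by (simp add: powr_realpow[symmetric] powr_powr mult.commute)
  then show ?thesis by (simp add: int_adjoin_power int_adjoin.gen)
next
  case False
  then have "q powr y = (q powr - r) ^ nat (- m)"
    using assms by (simp add: powr_realpow[symmetric] powr_powr mult.commute)
  then show ?thesis by (simp add: int_adjoin_power int_adjoin.gen)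
qed

text \<open>
  Here \<open>D\<close> is a common denominator: \<open>D = 1\<close> gives the scalars of the torus of \<open>DB\<close>, and the lcm of the
  denominators of \<open>\<Lambda>\<close> gives those of the torus of \<open>\<Lambda>\<close>.
\<close>

lemma powr_half_int_adjoin:
  assumes "q > 0" and "D > 0" and "of_int D * x \<in> (\<int> :: rat set)"
  shows "q powr of_rat (- (1/2) * x) \<in> int_adjoin {q powr (1 / (2 * of_int D)), q powr - (1 / (2 * of_int D))}"
proof -
  obtain m where m: "of_int D * x = of_int m" using assms(3) by (auto elim: Ints_cases)
  have "of_rat (of_int D * x) = (of_int m :: real)" unfolding m by simp
  then have "of_int D * of_rat x = (of_int m :: real)" by (simp add: of_rat_mult)
  then have "of_rat (- (1/2) * x) = (of_int (- m) * (1 / (2 * of_int D)) :: real)"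
    using assms(2) by (simp add: of_rat_mult of_rat_minus of_rat_divide field_simps)
  then show ?thesis by (rule powr_int_adjoin[OF assms(1)])
qed

section \<open>Normalized monomials\<close>

lemma torus_scale_single: "torus_scale c (Poly_Mapping.single a x) = Poly_Mapping.single a (c * x)"
  by (rule poly_mapping_eqI)
    (simp add: torus_scale_def Poly_Mapping.map.rep_eq lookup_single when_def)

lemma normalized_monom_eq:
  "normalized_monom q M a = Poly_Mapping.single a (q powr of_rat (normal_exp M a))"
  by (simp add: normalized_monom_def torus_monom_def torus_scale_single normal_exp_def)

lemma reorder_exp_zero_left: "reorder_exp M 0 b = 0"
  by (simp add: reorder_exp_def)

lemma torus_scale_eq_mult:
  "torus_scale c (Poly_Mapping.single a x) =
    torus_scalar c \<otimes>\<^bsub>quantum_torus R q M\<^esub> Poly_Mapping.single a x" if "q > 0"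
  using that by (simp add: torus_scale_single torus_scalar_def quantum_torus_mult_single reorder_exp_def)

text \<open>
  Written with the factor on the side of the products, so that it can be pushed through a ring
  homomorphism.
\<close>

lemma normalized_monom_add:
  assumes "transpose M = - M" and "q > 0"
  shows "normalized_monom q M (a + b) = torus_scalar (q powr of_rat (- (1/2) * torus_form M a b))
    \<otimes>\<^bsub>quantum_torus R q M\<^esub> (normalized_monom q M a \<otimes>\<^bsub>quantum_torus R q M\<^esub> normalized_monom q M b)"
proof -
  have "q powr of_rat (normal_exp M (a + b)) = q powr of_rat (- (1/2) * torus_form M a b) *
      (q powr of_rat (reorder_exp M a b) *
        (q powr of_rat (normal_exp M a) * q powr of_rat (normal_exp M b)))"
    unfolding normal_exp_add[OF assms(1)] by (simp only: of_rat_add powr_add)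
  moreover have "reorder_exp M 0 (a + b) = 0" by (simp add: reorder_exp_def)
  ultimately show ?thesis
    using assms(2)
    by (simp only: normalized_monom_eq torus_scalar_def quantum_torus_mult_single)
      (simp add: mult.assoc)
qed

lemma single_mem_quantum_torus:
  assumes "x \<in> int_adjoin S"
  shows "Poly_Mapping.single a x \<in> carrier (quantum_torus (int_adjoin S) q M)"
  using assms by (auto simp: quantum_torus_def lookup_single when_def int_adjoin_zero)

lemma lookup_torus_scale:
  "Poly_Mapping.lookup (torus_scale c f) a = c * Poly_Mapping.lookup f a"
  by (simp add: torus_scale_def Poly_Mapping.map.rep_eq when_def)

lemma torus_scale_mem:
  assumes "f \<in> carrier (quantum_torus (int_adjoin S) q M)" and "c \<in> int_adjoin S"
  shows "torus_scale c f \<in> carrier (quantum_torus (int_adjoin S) q M)"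
  using assms by (simp add: quantum_torus_def lookup_torus_scale int_adjoin.mult)

lemma zero_mem_quantum_torus: "0 \<in> carrier (quantum_torus (int_adjoin S) q M)"
  by (simp add: quantum_torus_def int_adjoin_zero)

lemma add_mem_quantum_torus:
  assumes "f \<in> carrier (quantum_torus (int_adjoin S) q M)" "g \<in> carrier (quantum_torus (int_adjoin S) q M)"
  shows "f + g \<in> carrier (quantum_torus (int_adjoin S) q M)"
  using assms by (simp add: quantum_torus_def lookup_add int_adjoin.add)

lemma of_int_denominator:
  assumes "\<And>i k. of_int D * M $ i $ k \<in> (\<int> :: rat set)"
  shows "of_int D * (\<Sum>(i, k)\<in>A. M $ i $ k * of_int (f i k)) \<in> (\<int> :: rat set)"
  unfolding sum_distrib_left
  by (intro Ints_sum) (use assms in \<open>auto simp: mult.assoc[symmetric] case_prod_unfold\<close>)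

lemma normalized_monom_mem:
  assumes "q > 0" and "D > 0" and "\<And>i k. of_int D * M $ i $ k \<in> (\<int> :: rat set)"
  shows "normalized_monom q M a \<in>
    carrier (quantum_torus (int_adjoin {q powr (1 / (2 * of_int D)), q powr - (1 / (2 * of_int D))}) q M')"
  unfolding normalized_monom_eq normal_exp_def
  by (intro single_mem_quantum_torus powr_half_int_adjoin of_int_denominator assms)

lemma normalized_monom_mult_mem:
  assumes q: "q > 0" and D: "D > 0" and M: "\<And>i k. of_int D * M $ i $ k \<in> (\<int> :: rat set)"
  shows "normalized_monom q M a \<otimes>\<^bsub>quantum_torus R' q M\<^esub> normalized_monom q M b \<in>
    carrier (quantum_torus (int_adjoin {q powr (1 / (2 * of_int D)), q powr - (1 / (2 * of_int D))}) q M')"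
proof -
  have "of_int D * (- 2 * reorder_exp M a b) = - 2 * (of_int D * reorder_exp M a b)" by simp
  also have "\<dots> \<in> \<int>"
    unfolding reorder_exp_def by (intro Ints_mult of_int_denominator M) auto
  finally have "q powr of_rat (- (1/2) * (- 2 * reorder_exp M a b)) \<in>
      int_adjoin {q powr (1 / (2 * of_int D)), q powr - (1 / (2 * of_int D))}"
    by (rule powr_half_int_adjoin[OF q D])
  then have "q powr of_rat (reorder_exp M a b) \<in>
      int_adjoin {q powr (1 / (2 * of_int D)), q powr - (1 / (2 * of_int D))}"
    by simp
  moreover have "q powr of_rat (normal_exp M c) \<in>
      int_adjoin {q powr (1 / (2 * of_int D)), q powr - (1 / (2 * of_int D))}" for c
    unfolding normal_exp_def
    by (intro powr_half_int_adjoin of_int_denominator q D M)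
  ultimately show ?thesis
    unfolding normalized_monom_eq quantum_torus_mult_single
    by (intro single_mem_quantum_torus int_adjoin.mult)
qed

lemma denominator_lcm_pos: "0 < denominator_lcm (M :: ('n::finite) rat_mat)"
proof -
  let ?S = "{snd (quotient_of (M $ i $ k)) | i k. True}"
  have S: "?S = (\<lambda>(i, k). snd (quotient_of (M $ i $ k))) ` UNIV" by auto
  have "finite ?S" unfolding S by simp
  moreover have "0 \<notin> ?S"
    using quotient_of_denom_pos' by (auto simp: less_le)
  ultimately have "Lcm ?S \<noteq> 0" by (simp add: Lcm_0_iff)
  then show ?thesis unfolding denominator_lcm_def using Lcm_int_greater_eq_0[of ?S] by linarith
qed

lemma denominator_lcm_mult: "of_int (denominator_lcm M) * M $ i $ k \<in> (\<int> :: rat set)"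
proof -
  let ?s = "snd (quotient_of (M $ i $ k))" and ?p = "fst (quotient_of (M $ i $ k))"
  have "?s dvd denominator_lcm M" unfolding denominator_lcm_def by (rule dvd_Lcm) blast
  then obtain m where m: "denominator_lcm M = ?s * m" by (auto elim: dvdE)
  have "M $ i $ k = of_int ?p / of_int ?s" by (rule quotient_of_div) simp
  moreover have "?s \<noteq> 0" using quotient_of_denom_pos'[of "M $ i $ k"] by linarith
  ultimately have "of_int (denominator_lcm M) * M $ i $ k = of_int (m * ?p)"
    unfolding m by (simp add: field_simps)
  then show ?thesis by (metis Ints_of_int)
qed

section \<open>Homomorphisms into skew fields\<close>

lemma skew_field_hom_inj:
  assumes K: "skew_field K" and K': "skew_field K'" and j: "j \<in> ring_hom K K'"
  shows "inj_on j (carrier K)"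
proof -
  interpret K: ring K using K by (simp add: skew_field_def)
  interpret K': ring K' using K' by (simp add: skew_field_def)
  interpret j: ring_hom_ring K K' j by (rule ring_hom_ringI2[OF K.ring_axioms K'.ring_axioms j])
  have "x = y" if x: "x \<in> carrier K" and y: "y \<in> carrier K" and eq: "j x = j y" for x y
  proof (rule ccontr)
    assume "x \<noteq> y"
    then have "x \<ominus>\<^bsub>K\<^esub> y \<in> carrier K - {\<zero>\<^bsub>K\<^esub>}" using x y by (simp add: K.r_right_minus_eq)
    then have U: "x \<ominus>\<^bsub>K\<^esub> y \<in> Units K" using K by (auto simp: skew_field_def)
    have "j (x \<ominus>\<^bsub>K\<^esub> y) = \<zero>\<^bsub>K'\<^esub>"
      using x y eq by (simp add: a_minus_def K'.r_neg)
    then have "j (x \<ominus>\<^bsub>K\<^esub> y) \<otimes>\<^bsub>K'\<^esub> j (inv\<^bsub>K\<^esub> (x \<ominus>\<^bsub>K\<^esub> y)) = \<zero>\<^bsub>K'\<^esub>"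
      using U by simp
    moreover have "j (x \<ominus>\<^bsub>K\<^esub> y) \<otimes>\<^bsub>K'\<^esub> j (inv\<^bsub>K\<^esub> (x \<ominus>\<^bsub>K\<^esub> y)) =
        j ((x \<ominus>\<^bsub>K\<^esub> y) \<otimes>\<^bsub>K\<^esub> inv\<^bsub>K\<^esub> (x \<ominus>\<^bsub>K\<^esub> y))"
      using U by (intro j.hom_mult[symmetric]) auto
    moreover have "\<dots> = \<one>\<^bsub>K'\<^esub>" using U by simp
    ultimately have "\<one>\<^bsub>K'\<^esub> = \<zero>\<^bsub>K'\<^esub>" by metis
    then show False using K' by (simp add: skew_field_def)
  qed
  then show ?thesis by (auto simp: inj_on_def)
qed

lemma ring_hom_quantum_torus_zero:
  assumes "ring K" and "\<iota> \<in> ring_hom (quantum_torus (int_adjoin S) q M) K"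
  shows "\<iota> 0 = \<zero>\<^bsub>K\<^esub>"
proof -
  interpret K: ring K by fact
  have z: "0 \<in> carrier (quantum_torus (int_adjoin S) q M)" by (rule zero_mem_quantum_torus)
  have "\<iota> (0 + 0) = \<iota> 0 \<oplus>\<^bsub>K\<^esub> \<iota> 0"
    using ring_hom_add[OF assms(2) z z] by (simp add: quantum_torus_def)
  moreover have "\<iota> 0 \<in> carrier K" using ring_hom_closed[OF assms(2) z] .
  ultimately show ?thesis by simp
qed

section \<open>The F-factor\<close>

text \<open>
  \<open>RZ\<close>, \<open>TZ\<close> and \<open>Zm\<close> stand for the scalars, the torus and the normalized monomials of \<open>DB\<close>, and \<open>RX\<close>,
  \<open>TX\<close> and \<open>Xm\<close> for those of \<open>\<Lambda>\<close>.
\<close>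

locale column_embedded =
  fixes q :: real and B :: "('n::{finite,linorder}) int_mat" and d :: "'n \<Rightarrow> nat"
    and KZ :: "'z ring" and iZ :: "'n torus \<Rightarrow> 'z"
    and KX :: "'x ring" and iX :: "'n torus \<Rightarrow> 'x" and j :: "'z \<Rightarrow> 'x"
  assumes Q: "invertible_valued_quiver B d" and q_pos: "q > 0"
    and KZ: "skew_field_of_fractions (torus_DB q B d) KZ iZ"
    and KX: "skew_field_of_fractions (torus_Lambda q B d) KX iX"
    and j: "column_embedding q B d KZ iZ KX iX j"
begin

definition D where "D = denominator_lcm (Lambda_matrix B d)"
definition RZ where "RZ = int_adjoin {q powr (1/2), q powr - (1/2)}"
definition RX where "RX = int_adjoin {q powr (1 / (2 * of_int D)), q powr - (1 / (2 * of_int D))}"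
abbreviation TZ where "TZ \<equiv> quantum_torus RZ q (DB_matrix B d)"
abbreviation TX where "TX \<equiv> quantum_torus RX q (Lambda_matrix B d)"
abbreviation Zm where "Zm \<equiv> normalized_monom q (DB_matrix B d)"
abbreviation Xm where "Xm \<equiv> normalized_monom q (Lambda_matrix B d)"

lemma torus_DB_eq: "torus_DB q B d = TZ"
  by (simp add: torus_DB_def RZ_def)

lemma torus_Lambda_eq: "torus_Lambda q B d = TX"
  by (simp add: torus_Lambda_def RX_def D_def Let_def)

lemma iZ_hom: "iZ \<in> ring_hom TZ KZ" and skew_KZ: "skew_field KZ"
  using KZ unfolding torus_DB_eq skew_field_of_fractions_def by auto

lemma iX_hom: "iX \<in> ring_hom TX KX" and skew_KX: "skew_field KX" and inj_iX: "inj_on iX (carrier TX)"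
  using KX unfolding torus_Lambda_eq skew_field_of_fractions_def by auto

lemma j_hom: "j \<in> ring_hom KZ KX"
  and j_scalar: "c \<in> RZ \<Longrightarrow> j (iZ (torus_scalar c)) = iX (torus_scalar c)"
  and j_var: "j (iZ (torus_monom (axis i 1))) = iX (Xm (column i B))"
  using j unfolding column_embedding_def RZ_def by auto

sublocale KZ: ring KZ using skew_KZ by (simp add: skew_field_def)
sublocale KX: ring KX using skew_KX by (simp add: skew_field_def)
sublocale j: ring_hom_ring KZ KX j
  by (rule ring_hom_ringI2[OF KZ.ring_axioms KX.ring_axioms j_hom])

lemma D_pos: "0 < D" unfolding D_def by (rule denominator_lcm_pos)

lemma RZ_subset_RX: "RZ \<subseteq> RX"
proof -
  have half: "(1/2 :: real) = of_int D * (1 / (2 * of_int D))" using D_pos by simp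
  have "q powr (1/2) \<in> RX"
    unfolding RX_def by (rule powr_int_adjoin[OF q_pos half])
  moreover have "q powr - (1/2) \<in> RX"
    unfolding RX_def by (rule powr_int_adjoin[OF q_pos, of _ "- D"]) (use D_pos in simp)
  ultimately show ?thesis
    unfolding RZ_def RX_def[symmetric] using int_adjoin_mono unfolding RX_def by simp
qed

lemma DB_int: "of_int 1 * DB_matrix B d $ i $ k \<in> (\<int> :: rat set)"
  unfolding DB_matrix_entry by simp

lemma Z_mem: "Zm e \<in> carrier TZ"
  using normalized_monom_mem[OF q_pos, of 1 "DB_matrix B d" e "DB_matrix B d"] DB_int
  by (simp add: RZ_def)

lemma X_mem: "Xm a \<in> carrier TX"
  unfolding RX_def D_def
  by (rule normalized_monom_mem[OF q_pos denominator_lcm_pos denominator_lcm_mult])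

lemma scalar_mem_TZ: "c \<in> RZ \<Longrightarrow> torus_scalar c \<in> carrier TZ"
  unfolding torus_scalar_def RZ_def by (rule single_mem_quantum_torus)

lemma scalar_mem_TX: "c \<in> RX \<Longrightarrow> torus_scalar c \<in> carrier TX"
  unfolding torus_scalar_def RX_def by (rule single_mem_quantum_torus)

lemma X_mult_mem: "Xm a \<otimes>\<^bsub>TX\<^esub> Xm b \<in> carrier TX"
  unfolding RX_def D_def
  by (rule normalized_monom_mult_mem[OF q_pos denominator_lcm_pos denominator_lcm_mult])

lemma Z_mult_mem: "Zm a \<otimes>\<^bsub>TZ\<^esub> Zm b \<in> carrier TZ"
  using normalized_monom_mult_mem[OF q_pos, where D = 1 and M = "DB_matrix B d" and
      M' = "DB_matrix B d" and R' = RZ and a = a and b = b] DB_int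
  by (simp add: RZ_def)

lemma normalized_monom_single_axis: "Zm (axis i 1) = torus_monom (axis i 1)"
  unfolding normalized_monom_eq normal_exp_axis torus_monom_def using q_pos by simp

lemma form_scalar_RZ: "q powr of_rat (- (1/2) * torus_form (DB_matrix B d) a b) \<in> RZ"
proof -
  have "of_int 1 * torus_form (DB_matrix B d) a b \<in> \<int>"
    unfolding torus_form_def DB_matrix_entry of_int_mult[symmetric] of_int_1
    by (simp only: mult_1_left of_int_mult[symmetric] of_int_sum[symmetric] Ints_of_int)
  from powr_half_int_adjoin[OF q_pos _ this] show ?thesis by (simp add: RZ_def)
qed

lemma scale_Z: "torus_scale c (Zm e) = torus_scalar c \<otimes>\<^bsub>TZ\<^esub> Zm e"
  unfolding normalized_monom_eq by (rule torus_scale_eq_mult[OF q_pos])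

lemma iX_product:
  assumes "c \<in> RX"
  shows "iX (torus_scalar c \<otimes>\<^bsub>TX\<^esub> (Xm a \<otimes>\<^bsub>TX\<^esub> Xm b)) =
    iX (torus_scalar c) \<otimes>\<^bsub>KX\<^esub> (iX (Xm a) \<otimes>\<^bsub>KX\<^esub> iX (Xm b))"
  using ring_hom_mult[OF iX_hom scalar_mem_TX[OF assms] X_mult_mem]
    ring_hom_mult[OF iX_hom X_mem X_mem] by simp

lemma iZ_product:
  assumes "c \<in> RZ"
  shows "iZ (torus_scalar c \<otimes>\<^bsub>TZ\<^esub> (Zm a \<otimes>\<^bsub>TZ\<^esub> Zm b)) =
    iZ (torus_scalar c) \<otimes>\<^bsub>KZ\<^esub> (iZ (Zm a) \<otimes>\<^bsub>KZ\<^esub> iZ (Zm b))"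
  using ring_hom_mult[OF iZ_hom scalar_mem_TZ[OF assms] Z_mult_mem]
    ring_hom_mult[OF iZ_hom Z_mem Z_mem] by simp

lemma iX_closed: "f \<in> carrier TX \<Longrightarrow> iX f \<in> carrier KX"
  using ring_hom_closed[OF iX_hom] .

lemma iZ_closed: "f \<in> carrier TZ \<Longrightarrow> iZ f \<in> carrier KZ"
  using ring_hom_closed[OF iZ_hom] .

lemma j_basis_step:
  assumes IH: "j (iZ (Zm e)) = iX (Xm (B *v e))"
  shows "j (iZ (Zm (e + axis i 1))) = iX (Xm (B *v (e + axis i 1)))"
proof -
  let ?c = "q powr of_rat (- (1/2) * torus_form (DB_matrix B d) e (axis i 1))"
  have c: "?c \<in> RZ" by (rule form_scalar_RZ)
  have cX: "?c \<in> RX" using c RZ_subset_RX by blast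
  have "B *v axis i 1 = column i B"
    by (simp add: column_def vec_eq_iff matrix_vector_mult_def axis_def if_distrib sum.delta
        cong: if_cong)
  moreover have "B *v (e + axis i 1) = B *v e + B *v axis i 1"
    by (simp only: vec_eq_iff matrix_vector_mult_def vector_add_component distrib_left sum.distrib
        vec_lambda_beta) simp
  ultimately have col: "B *v (e + axis i 1) = B *v e + column i B" by simp
  have "j (iZ (Zm (e + axis i 1))) =
      j (iZ (torus_scalar ?c) \<otimes>\<^bsub>KZ\<^esub> (iZ (Zm e) \<otimes>\<^bsub>KZ\<^esub> iZ (Zm (axis i 1))))"
    unfolding normalized_monom_add[OF DB_matrix_skew[OF Q] q_pos, where R = RZ] iZ_product[OF c] ..
  also have "\<dots> = iX (torus_scalar ?c) \<otimes>\<^bsub>KX\<^esub> (iX (Xm (B *v e)) \<otimes>\<^bsub>KX\<^esub> iX (Xm (column i B)))"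
    using iZ_closed Z_mem scalar_mem_TZ[OF c] j_scalar[OF c] IH j_var[of i]
    by (simp add: normalized_monom_single_axis[symmetric])
  also have "\<dots> = iX (Xm (B *v e + column i B))"
    unfolding normalized_monom_add[OF Lambda_matrix_skew[OF Q] q_pos, where R = RX]
      torus_form_column[OF Q] iX_product[OF cX] ..
  finally show ?thesis unfolding col .
qed

text \<open>
  Dimension vectors are nonnegative, so inverses of the \<open>Z\<^sub>i\<close> never have to be followed through \<open>j\<close> and
  an induction that adds one basis vector at a time is enough.
\<close>

lemma j_monom:
  assumes "\<forall>i. 0 \<le> e $ i"
  shows "j (iZ (Zm e)) = iX (Xm (B *v e))"
  using assms
proof (induction "nat (\<Sum>i\<in>UNIV. e $ i)" arbitrary: e)
  case 0
  then have "(\<Sum>i\<in>UNIV. e $ i) = 0" by (simp add: sum_nonneg order.antisym)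
  then have "e = 0" using 0(2) by (simp add: sum_nonneg_eq_0_iff vec_eq_iff)
  then have "Zm e = torus_scalar 1" and "Xm (B *v e) = torus_scalar 1"
    using q_pos by (simp_all add: normalized_monom_eq normal_exp_def torus_scalar_def)
  moreover have "1 \<in> RZ" using int_adjoin_of_nat[of 1] by (simp add: RZ_def)
  ultimately show ?case using j_scalar by simp
next
  case (Suc n)
  have "\<exists>i. e $ i \<noteq> 0"
  proof (rule ccontr)
    assume "\<not> ?thesis"
    then show False using Suc(2) by simp
  qed
  then obtain i where i: "0 < e $ i" using Suc(3) by (metis order_le_less)
  define e' where "e' = e - axis i 1"
  have nn: "\<forall>k. 0 \<le> e' $ k" using Suc(3) i by (auto simp: e'_def axis_def)
  have "(\<Sum>k\<in>UNIV. e' $ k) = (\<Sum>k\<in>UNIV. e $ k) - 1"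
    by (simp add: e'_def sum_subtractf axis_def)
  then have "n = nat (\<Sum>k\<in>UNIV. e' $ k)" using Suc(2) by linarith
  then have "j (iZ (Zm e')) = iX (Xm (B *v e'))" using Suc(1) nn by blast
  from j_basis_step[OF this, of i] show ?case by (simp add: e'_def)
qed

lemma X_shift:
  "Xm (B *v e - left_star B d v) =
    torus_scalar (q powr (of_int (euler_form B d e v) / 2)) \<otimes>\<^bsub>TX\<^esub>
      (Xm (B *v e) \<otimes>\<^bsub>TX\<^esub> Xm (- left_star B d v))"
proof -
  have half: "of_rat (- (1/2) * torus_form (Lambda_matrix B d) (B *v e) (- left_star B d v)) =
      (of_int (euler_form B d e v) / 2 :: real)"
    unfolding torus_form_left_star[OF Q] by (simp add: of_rat_divide of_rat_mult)
  have "Xm (B *v e + - left_star B d v) =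
      torus_scalar (q powr of_rat (- (1/2) * torus_form (Lambda_matrix B d) (B *v e) (- left_star B d v)))
        \<otimes>\<^bsub>TX\<^esub> (Xm (B *v e) \<otimes>\<^bsub>TX\<^esub> Xm (- left_star B d v))"
    by (rule normalized_monom_add[OF Lambda_matrix_skew[OF Q] q_pos])
  then show ?thesis unfolding half by simp
qed

text \<open>
  One summand of the character. The exponents combine to
  \<open>-\<langle>e, v - e\<rangle>/2 + \<langle>e, v\<rangle>/2 = \<langle>e, e\<rangle>/2\<close>, so the dependence on \<open>v\<close> disappears.
\<close>

lemma character_term:
  fixes N :: nat and e :: "'n int_vec"
  defines "f \<equiv> q powr (of_int (euler_form B d e e) / 2) * real N"
  assumes f: "f \<in> RZ" and e: "\<forall>i. 0 \<le> e $ i"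
  shows "torus_scale (q powr (- (1/2) * of_int (euler_form B d e (v - e))) * real N)
      (Xm (B *v e - left_star B d v)) \<in> carrier TX" (is "?t \<in> _")
    and "torus_scale f (Zm e) \<in> carrier TZ"
    and "iX (torus_scale (q powr (- (1/2) * of_int (euler_form B d e (v - e))) * real N)
      (Xm (B *v e - left_star B d v))) =
      j (iZ (torus_scale f (Zm e))) \<otimes>\<^bsub>KX\<^esub> iX (Xm (- left_star B d v))"
proof -
  have fX: "f \<in> RX" using f RZ_subset_RX by blast
  let ?u = "Xm (- left_star B d v)"
  have t: "?t = torus_scalar f \<otimes>\<^bsub>TX\<^esub> (Xm (B *v e) \<otimes>\<^bsub>TX\<^esub> ?u)"
  proof -
    have "q powr (- (1/2) * of_int (euler_form B d e (v - e))) * q powr (of_int (euler_form B d e v) / 2) =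
        q powr (of_int (euler_form B d e e) / 2)"
      by (simp add: powr_add[symmetric] euler_form_diff_right diff_divide_distrib)
    then have fe: "q powr (- (1/2) * of_int (euler_form B d e (v - e))) * real N *
        q powr (of_int (euler_form B d e v) / 2) = f"
      unfolding f_def by (simp add: ac_simps)
    show ?thesis
      unfolding X_shift fe[symmetric]
      unfolding normalized_monom_eq torus_scalar_def quantum_torus_mult_single torus_scale_single
      using q_pos by (simp add: reorder_exp_zero_left mult.assoc)
  qed
  have gX: "q powr (- (1/2) * of_int (euler_form B d e (v - e))) * real N \<in> RX"
  proof -
    have "q powr (- (1/2) * of_int (euler_form B d e (v - e))) \<in> RZ"
      unfolding RZ_def by (rule powr_int_adjoin[OF q_pos, of _ "- euler_form B d e (v - e)"]) simp
    then show ?thesis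
      using RZ_subset_RX int_adjoin_of_nat int_adjoin.mult unfolding RX_def by blast
  qed
  have Xu: "iX (Xm (B *v e)) \<in> carrier KX" "iX ?u \<in> carrier KX" "iX (torus_scalar f) \<in> carrier KX"
    using iX_closed X_mem scalar_mem_TX[OF fX] by auto
  have Zf: "torus_scale f (Zm e) = torus_scalar f \<otimes>\<^bsub>TZ\<^esub> Zm e" by (rule scale_Z)
  have Zfe: "iZ (torus_scale f (Zm e)) = iZ (torus_scalar f) \<otimes>\<^bsub>KZ\<^esub> iZ (Zm e)"
    unfolding Zf using ring_hom_mult[OF iZ_hom scalar_mem_TZ[OF f] Z_mem] .
  have "iX ?t = (iX (torus_scalar f) \<otimes>\<^bsub>KX\<^esub> iX (Xm (B *v e))) \<otimes>\<^bsub>KX\<^esub> iX ?u"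
    unfolding t iX_product[OF fX] using Xu by (simp add: KX.m_assoc)
  also have "\<dots> = j (iZ (torus_scale f (Zm e))) \<otimes>\<^bsub>KX\<^esub> iX ?u"
    unfolding Zfe using iZ_closed Z_mem scalar_mem_TZ[OF f] j_scalar[OF f] j_monom[OF e] by simp
  finally show "iX ?t = j (iZ (torus_scale f (Zm e))) \<otimes>\<^bsub>KX\<^esub> iX ?u" .
  show "torus_scale f (Zm e) \<in> carrier TZ"
    using torus_scale_mem Z_mem f unfolding RZ_def by blast
  show "?t \<in> carrier TX"
    using torus_scale_mem X_mem gX unfolding RX_def by blast
qed

lemma sum_transport:
  assumes "finite S"
    and "\<And>e. e \<in> S \<Longrightarrow> g e \<in> carrier TX" and "\<And>e. e \<in> S \<Longrightarrow> h e \<in> carrier TZ"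
    and "\<And>e. e \<in> S \<Longrightarrow> iX (g e) = j (iZ (h e)) \<otimes>\<^bsub>KX\<^esub> u" and u: "u \<in> carrier KX"
  shows "sum g S \<in> carrier TX \<and> sum h S \<in> carrier TZ \<and>
    iX (sum g S) = j (iZ (sum h S)) \<otimes>\<^bsub>KX\<^esub> u"
  using assms(1-4)
proof (induction S rule: finite_induct)
  case empty
  have "iX 0 = \<zero>\<^bsub>KX\<^esub>"
    using ring_hom_quantum_torus_zero[OF KX.ring_axioms iX_hom[unfolded RX_def]] .
  moreover have "iZ 0 = \<zero>\<^bsub>KZ\<^esub>"
    using ring_hom_quantum_torus_zero[OF KZ.ring_axioms iZ_hom[unfolded RZ_def]] .
  ultimately show ?case using u by (simp add: RX_def RZ_def zero_mem_quantum_torus)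
next
  case (insert e S)
  have gh: "g e \<in> carrier TX" "h e \<in> carrier TZ" "iX (g e) = j (iZ (h e)) \<otimes>\<^bsub>KX\<^esub> u"
    using insert.prems by auto
  have IH: "sum g S \<in> carrier TX" "sum h S \<in> carrier TZ"
    "iX (sum g S) = j (iZ (sum h S)) \<otimes>\<^bsub>KX\<^esub> u"
    using insert.IH insert.prems by auto
  have "iX (g e + sum g S) = iX (g e) \<oplus>\<^bsub>KX\<^esub> iX (sum g S)"
    using ring_hom_add[OF iX_hom gh(1) IH(1)] by (simp add: quantum_torus_def)
  moreover have "iZ (h e + sum h S) = iZ (h e) \<oplus>\<^bsub>KZ\<^esub> iZ (sum h S)"
    using ring_hom_add[OF iZ_hom gh(2) IH(2)] by (simp add: quantum_torus_def)
  moreover have "g e + sum g S \<in> carrier TX" "h e + sum h S \<in> carrier TZ"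
    using add_mem_quantum_torus gh(1,2) IH(1,2) unfolding RX_def RZ_def by blast+
  ultimately show ?case
    using insert.hyps gh IH u iZ_closed by (simp add: KX.l_distr)
qed

text \<open>
  Uniqueness of the F-factor: \<open>X\<^bsup>(a)\<^esup>\<close> is invertible in the skew field, and a homomorphism of skew
  fields is injective.
\<close>

lemma right_cancel_X:
  assumes "f \<in> carrier KZ" "f' \<in> carrier KZ"
    and eq: "j f \<otimes>\<^bsub>KX\<^esub> iX (Xm a) = j f' \<otimes>\<^bsub>KX\<^esub> iX (Xm a)"
  shows "f = f'"
proof -
  have "Poly_Mapping.lookup (Xm a) a \<noteq> 0"
    unfolding normalized_monom_eq using q_pos by simp
  then have "Xm a \<noteq> 0" by auto
  then have "iX (Xm a) \<noteq> iX 0"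
    using inj_iX X_mem zero_mem_quantum_torus unfolding RX_def inj_on_def by blast
  then have "iX (Xm a) \<in> carrier KX - {\<zero>\<^bsub>KX\<^esub>}"
    using iX_closed[OF X_mem] ring_hom_quantum_torus_zero[OF KX.ring_axioms iX_hom[unfolded RX_def]]
    by simp
  then have U: "iX (Xm a) \<in> Units KX" using skew_KX unfolding skew_field_def by blast
  have "j f = (j f \<otimes>\<^bsub>KX\<^esub> iX (Xm a)) \<otimes>\<^bsub>KX\<^esub> inv\<^bsub>KX\<^esub> iX (Xm a)"
    using U assms(1) iX_closed[OF X_mem] KX.Units_inv_closed[OF U]
    by (simp add: KX.m_assoc KX.Units_r_inv)
  also have "\<dots> = j f'"
    unfolding eq using U assms(2) iX_closed[OF X_mem] KX.Units_inv_closed[OF U]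
    by (simp add: KX.m_assoc KX.Units_r_inv)
  finally show ?thesis
    using skew_field_hom_inj[OF skew_KZ skew_KX j_hom] assms(1,2) by (auto dest: inj_onD)
qed

end


lemma euler_form_half_power:
  assumes "0 \<le> euler_form B d e e" and "q > (0::real)"
  shows "q powr (of_int (euler_form B d e e) / 2) = (q powr (1/2)) ^ nat (euler_form B d e e)"
  using assms by (simp add: powr_realpow[symmetric] powr_powr)

theorem corollary1p8:
  fixes B :: "('n::{finite,linorder}) int_mat"
    and d :: "'n \<Rightarrow> nat"
    and L :: "'k ring" and F :: "'k set"
    and q :: real
    and K\<^sub>Z :: "'z ring" and \<iota>\<^sub>Z :: "'n torus \<Rightarrow> 'z"
    and K\<^sub>X :: "'x ring" and \<iota>\<^sub>X :: "'n torus \<Rightarrow> 'x"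
    and j :: "'z \<Rightarrow> 'x"
    and V :: "('n, 'k, 'v) valued_rep"
  assumes "invertible_valued_quiver B d" and "of_finite_type B"
    and "algebraic_closure L F" and "finite F" and "q = real (card F)"
    and "skew_field_of_fractions (torus_DB q B d) K\<^sub>Z \<iota>\<^sub>Z"
    and "skew_field_of_fractions (torus_Lambda q B d) K\<^sub>X \<iota>\<^sub>X"
    and "column_embedding q B d K\<^sub>Z \<iota>\<^sub>Z K\<^sub>X \<iota>\<^sub>X j"
    and "valued_representation L F B d V" and "indecomposable_rep L F B d V"
  shows "F_factor L F B d K\<^sub>Z K\<^sub>X \<iota>\<^sub>X j V \<in> \<iota>\<^sub>Z ` one_plus_positive q B d"
proof -
  interpret C: algebraic_closure L F by fact
  have q: "q > 0"
    using C.finite_subfield_card[OF C.subfield_axioms assms(4)] assms(5) by simp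
  have d: "0 < d i" for i using assms(1) by (simp add: invertible_valued_quiver_def)
  interpret R: finite_valued_rep L F B d V
    by unfold_locales (use assms(3,4,9) d in auto)
  interpret E: column_embedded q B d K\<^sub>Z \<iota>\<^sub>Z K\<^sub>X \<iota>\<^sub>X j
    by unfold_locales (use assms(1,6,7,8) q in auto)
  define v where "v = total_dim_vector L F d V"
  define S where "S = {e. quiver_Gr L F B d V e \<noteq> {}}"
  define f where "f e = q powr (of_int (euler_form B d e e) / 2) * real (card (quiver_Gr L F B d V e))" for e
  define Zm where "Zm = normalized_monom q (DB_matrix B d)"
  define Xm where "Xm = normalized_monom q (Lambda_matrix B d)"
  define g where "g e = torus_scale (q powr (- (1/2) * of_int (euler_form B d e (v - e))) *
      real (card (quiver_Gr L F B d V e))) (Xm (B *v e - left_star B d v))" for e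
  have S: "finite S" unfolding S_def by (rule R.finite_nonempty_Gr)
  have nonneg: "\<forall>i. 0 \<le> e $ i" if "e \<in> S" for e
    using R.nonempty_Gr_nonneg that unfolding S_def by blast
  have pos: "0 < euler_form B d e e" if "e \<noteq> 0" for e
    using euler_form_pos[OF assms(1,2) that] .
  have f_pos: "\<exists>x\<in>int_adjoin {q powr (1/2)}. f e = q powr (1/2) * x" if "e \<noteq> 0" for e
  proof -
    \<comment> \<open>\<open>\<langle>e, e\<rangle> \<ge> 1\<close> leaves a factor \<open>q\<^bsup>1/2\<^esup>\<close> to split off.\<close>
    let ?x = "(q powr (1/2)) ^ nat (euler_form B d e e - 1) * real (card (quiver_Gr L F B d V e))"
    have "nat (euler_form B d e e) = Suc (nat (euler_form B d e e - 1))" using pos[OF that] by simp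
    then have "f e = q powr (1/2) * ?x"
      unfolding f_def using euler_form_half_power[OF _ q, of B d e] pos[OF that] by simp
    moreover have "?x \<in> int_adjoin {q powr (1/2)}"
      by (intro int_adjoin.mult int_adjoin_power int_adjoin.gen int_adjoin_of_nat) simp
    ultimately show ?thesis by blast
  qed
  have f0: "f 0 = 1"
    unfolding f_def R.Gr_zero by (simp add: euler_form_def q[THEN less_imp_neq, symmetric])
  have fRZ: "f e \<in> E.RZ" for e
  proof (cases "e = 0")
    case True
    then show ?thesis using f0 int_adjoin_of_nat[of 1] by (simp add: E.RZ_def)
  next
    case False
    have "int_adjoin {q powr (1/2)} \<subseteq> E.RZ"
      unfolding E.RZ_def by (rule int_adjoin_mono) (simp add: int_adjoin.gen)
    moreover have "q powr (1/2) \<in> E.RZ" unfolding E.RZ_def by (rule int_adjoin.gen) simp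
    moreover obtain x where "x \<in> int_adjoin {q powr (1/2)}" "f e = q powr (1/2) * x"
      using f_pos[OF False] by (elim bexE)
    ultimately show ?thesis
      unfolding E.RZ_def by (simp add: int_adjoin.mult subsetD)
  qed
  have summand: "g e \<in> carrier E.TX" "torus_scale (f e) (Zm e) \<in> carrier E.TZ"
    "\<iota>\<^sub>X (g e) = j (\<iota>\<^sub>Z (torus_scale (f e) (Zm e))) \<otimes>\<^bsub>K\<^sub>X\<^esub> \<iota>\<^sub>X (Xm (- left_star B d v))"
    if "e \<in> S" for e
    unfolding g_def f_def Zm_def Xm_def
    by (rule E.character_term[OF fRZ[unfolded f_def] nonneg[OF that]])+
  have u: "\<iota>\<^sub>X (Xm (- left_star B d v)) \<in> carrier K\<^sub>X"
    unfolding Xm_def using E.iX_closed E.X_mem by blast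
  have sums: "sum g S \<in> carrier E.TX" "(\<Sum>e\<in>S. torus_scale (f e) (Zm e)) \<in> carrier E.TZ"
    "\<iota>\<^sub>X (sum g S) = j (\<iota>\<^sub>Z (\<Sum>e\<in>S. torus_scale (f e) (Zm e))) \<otimes>\<^bsub>K\<^sub>X\<^esub> \<iota>\<^sub>X (Xm (- left_star B d v))"
    using E.sum_transport[where g = g and h = "\<lambda>e. torus_scale (f e) (Zm e)", OF S summand u]
    by simp_all
  have character: "cluster_character L F B d V = sum g S"
    unfolding cluster_character_def Let_def S_def g_def v_def Xm_def assms(5) ..
  have "F_factor L F B d K\<^sub>Z K\<^sub>X \<iota>\<^sub>X j V = \<iota>\<^sub>Z (\<Sum>e\<in>S. torus_scale (f e) (Zm e))"
    unfolding F_factor_def character assms(5)[symmetric] v_def[symmetric] Xm_def[symmetric]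
  proof (rule the_equality)
    show "\<iota>\<^sub>Z (\<Sum>e\<in>S. torus_scale (f e) (Zm e)) \<in> carrier K\<^sub>Z \<and> \<iota>\<^sub>X (sum g S) =
        j (\<iota>\<^sub>Z (\<Sum>e\<in>S. torus_scale (f e) (Zm e))) \<otimes>\<^bsub>K\<^sub>X\<^esub> \<iota>\<^sub>X (Xm (- left_star B d v))"
      using sums E.iZ_closed by blast
    then show "f' = \<iota>\<^sub>Z (\<Sum>e\<in>S. torus_scale (f e) (Zm e))"
      if "f' \<in> carrier K\<^sub>Z \<and> \<iota>\<^sub>X (sum g S) = j f' \<otimes>\<^bsub>K\<^sub>X\<^esub> \<iota>\<^sub>X (Xm (- left_star B d v))" for f'
      using that E.right_cancel_X unfolding Xm_def by metis
  qed
  moreover have "(\<Sum>e\<in>S. torus_scale (f e) (Zm e)) \<in> one_plus_positive q B d"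
  proof -
    have "0 \<in> S" unfolding S_def using R.Gr_zero by simp
    moreover have "torus_scale (f 0) (Zm 0) = \<one>\<^bsub>torus_DB q B d\<^esub>"
      unfolding f0 Zm_def normalized_monom_eq torus_scale_single torus_DB_def quantum_torus_def
      using q by (simp add: normal_exp_def)
    ultimately have "(\<Sum>e\<in>S. torus_scale (f e) (Zm e)) =
        \<one>\<^bsub>torus_DB q B d\<^esub> + (\<Sum>e\<in>S - {0}. torus_scale (f e) (Zm e))"
      using S by (simp add: sum.remove)
    moreover have "S - {0} \<subseteq> {e. (\<forall>i. 0 \<le> e $ i) \<and> e \<noteq> 0}" using nonneg by blast
    moreover have "\<forall>e\<in>S - {0}. \<exists>x\<in>int_adjoin {q powr (1/2)}. f e = q powr (1/2) * x"
      using f_pos by blast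
    ultimately show ?thesis
      unfolding one_plus_positive_def Zm_def using S by blast
  qed
  ultimately show ?thesis by blast
qed

end
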